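(* For all $(n,m)\in\mathbb{Z}^2$ and all $\xi\in(0,\infty)$, with $$C^m_n:=2^{11/4-2m-3n}\,3^{-3/8}\,\left(\tfrac14\right)_m\left(\tfrac{13}{12}\right)_{m+n}^{-1}\Gamma(\tfrac43)^{-1},$$ one has $$\frac2\pi\,\hat Q_{-\frac34-m}^{-\frac13-n}(\coth\xi)=C^m_n\,(\sinh\xi)^{1/4-m}\left[-(-1)^n\sqrt{\sqrt3+1}\;A_+^{1/4+3m+3n}\,r^m_n(-A_-/A_+)\right],$$ $$\frac2\pi\,\hat Q_{-\frac14+m}^{-\frac13-n}(\coth\xi)=C^m_n\,(\sinh\xi)^{1/4-m}\left[+(-1)^m\sqrt{\sqrt3-1}\;A_-^{1/4+3m+3n}\,r^m_n(-A_+/A_-)\right],$$ where $\hat Q_\nu^\mu$ is the normalized second-kind Legendre function, $r^m_n$ are the octahedral functions defined in the context, and $A_\pm=A_\pm(\xi)=\pm\cosh(\xi/3)+\sqrt{\frac{4\cosh^2(\xi/3)-1}{3}}>0$.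
   Context: $\hat Q_\nu^\mu:=e^{-\mu\pi{\rm i}}Q_\nu^\mu$, where $Q_\nu^\mu$ is the usual associated Legendre function of the second kind; explicitly, for $z>1$, $$\hat Q_\nu^\mu(z)=\frac{\sqrt\pi}{2^{\nu+1}}\frac{\Gamma(\nu+\mu+1)}{\Gamma(\nu+3/2)}\frac{(z^2-1)^{\mu/2}}{z^{\nu+\mu+1}}\,{}_2F_1\!\left(\tfrac\nu2+\tfrac\mu2+\tfrac12,\tfrac\nu2+\tfrac\mu2+1;\nu+\tfrac32;\tfrac1{z^2}\right).$$ The rising factorial is extended to all integers $k$: $(d)_k=d(d+1)\cdots(d+k-1)$ for $k\ge0$ and $(d)_k=[(d-k')\cdots(d-1)]^{-1}$ for $k=-k'\le0$. Octahedral functions: let $p_{\rm v}(u)=u(1-u)^4$, $p_{\rm e}(u)=(1+u)(1-34u+u^2)$, $p_{\rm f}(u)=1+14u+u^2$, and $R(u)=-108\,p_{\rm v}(u)/p_{\rm e}(u)^2=1-p_{\rm f}(u)^3/p_{\rm e}(u)^2$. For $(n,m)\in\mathbb{Z}^2$, $r^m_n$ is the rational function of $u$ that on a neighborhood of $u=0$ satisfies $${}_2F_1\!\left(-\tfrac1{24}-\tfrac m2-\tfrac n2,\ \tfrac{11}{24}-\tfrac m2-\tfrac n2;\ \tfrac34-m;\ R(u)\right)=p_{\rm e}(u)^{-1/12-m-n}\,r^m_n(u)$$ (with powers of $p_{\rm e}(u)$ equal to $1$ at $u=0$). *)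

theory Defs
  imports
    "HOL-Analysis.Analysis"
    "HOL-Computational_Algebra.Computational_Algebra"
begin

text \<open>
  The sum of the Gauss hypergeometric series; meant for \<open>norm z < 1\<close> and \<open>c\<close> not a
  nonpositive integer. No analytic continuation to larger \<open>z\<close> is built in.
\<close>

definition hyp2F1 :: "'a \<Rightarrow> 'a \<Rightarrow> 'a \<Rightarrow> 'a \<Rightarrow> 'a :: {banach, real_normed_field}" where
  "hyp2F1 a b c z = eval_fps (fps_hypergeo [a, b] [c] 1) z"

text \<open>
  The normalized function \<open>exp (- \<mu> \<pi> \<i>) Q\<^sub>\<nu>\<^sup>\<mu>(z)\<close>, where \<open>Q\<close> is the associated Legendre
  function of the second kind, of degree \<open>\<nu>\<close> and order \<open>\<mu>\<close>; meant for real \<open>z > 1\<close>.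
\<close>

definition legendre_Qhat :: "real \<Rightarrow> real \<Rightarrow> real \<Rightarrow> real" where
  "legendre_Qhat \<nu> \<mu> z =
     sqrt pi / 2 powr (\<nu> + 1) * (Gamma (\<nu> + \<mu> + 1) / Gamma (\<nu> + 3/2)) *
     ((z\<^sup>2 - 1) powr (\<mu> / 2) / z powr (\<nu> + \<mu> + 1)) *
     hyp2F1 (\<nu>/2 + \<mu>/2 + 1/2) (\<nu>/2 + \<mu>/2 + 1) (\<nu> + 3/2) (1 / z\<^sup>2)"

definition rising_fact :: "'a :: field_char_0 \<Rightarrow> int \<Rightarrow> 'a" where
  "rising_fact d k =
     (if k \<ge> 0 then pochhammer d (nat k)
      else inverse (\<Prod>i = 1..nat (- k). d - of_nat i))"

definition p_v :: "complex \<Rightarrow> complex" where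
  "p_v u = u * (1 - u) ^ 4"

definition p_e :: "complex \<Rightarrow> complex" where
  "p_e u = (1 + u) * (1 - 34 * u + u\<^sup>2)"

definition p_f :: "complex \<Rightarrow> complex" where
  "p_f u = 1 + 14 * u + u\<^sup>2"

definition R_oct :: "complex \<Rightarrow> complex" where
  "R_oct u = - 108 * p_v u / (p_e u)\<^sup>2"

lemma R_oct_altdef: "p_e u \<noteq> 0 \<Longrightarrow> R_oct u = 1 - p_f u ^ 3 / (p_e u)\<^sup>2"
proof -
  assume "p_e u \<noteq> 0"
  moreover have "- 108 * p_v u = (p_e u)\<^sup>2 - p_f u ^ 3"
    unfolding p_v_def p_e_def p_f_def by algebra
  ultimately show ?thesis
    by (simp add: R_oct_def diff_divide_distrib)
qed

text \<open>
  A rational function is represented by a reduced quotient of polynomials, so that its value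
  at every non-pole is the correct one (at a pole it is \<open>0\<close>, by \<open>x / 0 = 0\<close>).
\<close>

definition rational_fun :: "(complex \<Rightarrow> complex) \<Rightarrow> bool" where
  "rational_fun r \<longleftrightarrow>
     (\<exists>p q. q \<noteq> 0 \<and> coprime p q \<and> (\<forall>u. r u = poly p u / poly q u))"

text \<open>
  The octahedral function \<open>r\<^sub>n\<^sup>m\<close>. On a small neighbourhood of \<open>0\<close> the value \<open>p_e u\<close> is close
  to \<open>1\<close>, so the principal power is the branch that equals \<open>1\<close> at \<open>u = 0\<close>.
\<close>

definition oct_r :: "int \<Rightarrow> int \<Rightarrow> complex \<Rightarrow> complex" where
  "oct_r n m = (THE r. rational_fun r \<and>
     (\<forall>\<^sub>F u in nhds 0.
        hyp2F1 (- 1/24 - of_int m / 2 - of_int n / 2)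
               (11/24 - of_int m / 2 - of_int n / 2)
               (3/4 - of_int m) (R_oct u)
        = p_e u powr (- 1/12 - of_int m - of_int n) * r u))"

definition A_plus :: "real \<Rightarrow> real" where
  "A_plus \<xi> = cosh (\<xi> / 3) + sqrt ((4 * (cosh (\<xi> / 3))\<^sup>2 - 1) / 3)"

definition A_minus :: "real \<Rightarrow> real" where
  "A_minus \<xi> = - cosh (\<xi> / 3) + sqrt ((4 * (cosh (\<xi> / 3))\<^sup>2 - 1) / 3)"

definition C_oct :: "int \<Rightarrow> int \<Rightarrow> real" where
  "C_oct n m =
     2 powr (11/4 - 2 * of_int m - 3 * of_int n) * 3 powr (- 3/8) *
     rising_fact (1/4) m * inverse (rising_fact (13/12) (m + n)) * inverse (Gamma (4/3))"

definition coth :: "real \<Rightarrow> real" where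
  "coth \<xi> = cosh \<xi> / sinh \<xi>"

end

theory Submission
  imports Defs "HOL-Complex_Analysis.Complex_Analysis"
begin

text \<open>
  Put \<open>s = - 1/12 - m - n\<close>, \<open>c = 3/4 - m\<close> and \<open>x = tanh\<^sup>2 \<xi>\<close>. Up to a common elementary factor the two
  Legendre functions are the two Frobenius solutions at \<open>x = 0\<close> of one hypergeometric equation, and
  \<open>x = R(u)\<close> both for \<open>u = - A\<^sub>- / A\<^sub>+\<close> and for its inverse. Suitably normalized, the two solutions satisfy
  the same contiguity relations when \<open>s\<close> and \<open>c\<close> are shifted by integers. Divide the first solution
  by \<open>p\<^sub>e(u)\<^sup>s\<close> on \<open>- 1 < u < 0\<close> and the second one by \<open>\<bar>p\<^sub>e(u)\<bar>\<^sup>s\<close> on \<open>u < - 1\<close>. For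
  \<open>m = n = 0\<close> both quotients are constants, which is checked with a Wronskian, and the second solution
  can be scaled so that they are equal. The contiguity relations have rational
  coefficients in \<open>u\<close>, so for all \<open>m\<close> and \<open>n\<close> the two quotients are values of a single rational
  function. By the identity theorem at \<open>u = 0\<close> it is a multiple of \<open>r\<^sub>n\<^sup>m\<close>. The constants
  come from the reflection, duplication and triplication formulas for the Gamma function.
\<close>

subsection \<open>Gauss hypergeometric series\<close>

text \<open>The obstacle is the argument of \<open>oct_r\<close> in the second formula. There
  \<open>u < - 1\<close>, while \<open>oct_r\<close> is defined by an identity near
  \<open>u = 0\<close>. On the real axis the two regions are separated by an interval on which
  \<open>R\<close> leaves the unit interval, with a pole at \<open>u = - 1\<close>, so the
  hypergeometric series does not lead from one to the other. For this reason rationality is proved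
  with one pair of polynomials for both regions together, and only the region next to
  \<open>0\<close> is compared with the definition of \<open>oct_r\<close>. That the two quotients
  can agree at all comes from a symmetry. For \<open>m = n = 0\<close> the two solutions, pulled
  back to \<open>- 1 < u < 0\<close>, are multiples of \<open>p_e(u) powr (- 1/12)\<close> and of
  \<open>|u| powr (1/4) * p_e(u) powr (- 1/12)\<close>. Since
  \<open>p_e(1/u) = p_e(u) / u^3\<close>, the substitution of \<open>1/u\<close> for
  \<open>u\<close> turns the second of these into a multiple of
  \<open>|p_e(u)| powr (- 1/12)\<close>, which has the form of the first.\<close>

lemma fps_conv_radius_hypergeo_21:
  fixes a b c :: "'a :: {banach, real_normed_field}"
  shows "fps_conv_radius (fps_hypergeo [a, b] [c] 1) \<ge> 1"
\<comment> \<open>The ratio test needs nonzero coefficients. Once one coefficient is zero, the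
  recursion makes all later ones zero. This occurs when \<open>a\<close> or \<open>b\<close> is a
  nonpositive integer and, because of \<open>x / 0 = 0\<close>, also when \<open>c\<close> is
  one.\<close>
proof (cases "\<exists>N. fps_nth (fps_hypergeo [a, b] [c] 1) N = 0")
  case True
  then obtain N where N: "fps_nth (fps_hypergeo [a, b] [c] 1) N = 0" by blast
  have z: "fps_nth (fps_hypergeo [a, b] [c] 1) n = 0" if "n \<ge> N" for n
    using that
  proof (induction n rule: dec_induct)
    case (step n)
    then show ?case by (subst fps_hypergeo_rec) (simp del: fps_hypergeo_nth)
  qed (use N in simp)
  have "summable (\<lambda>n. fps_nth (fps_hypergeo [a, b] [c] 1) n * of_real r ^ n)" for r
    by (rule summable_finite[of "{..<N}"]) (use z in \<open>auto simp del: fps_hypergeo_nth\<close>)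
  then show ?thesis
    unfolding fps_conv_radius_def by (intro conv_radius_geI_ex') auto
next
  case False
  define h where "h n = fps_nth (fps_hypergeo [a, b] [c] 1) n" for n
  have nz: "h n \<noteq> 0" for n using False unfolding h_def by blast
  have rec: "h (Suc n) = (a + of_nat n) * (b + of_nat n) / (of_nat (Suc n) * (c + of_nat n)) * h n" for n
    unfolding h_def by (subst fps_hypergeo_rec) simp
  have q: "h n / h (Suc n) = (1 + of_nat n) * (c + of_nat n) / ((a + of_nat n) * (b + of_nat n))" for n
    using nz[of n] nz[of "Suc n"] unfolding rec[of n] by auto
  have lin: "(\<lambda>n. (x + of_nat n) / of_nat n) \<longlonglongrightarrow> 1" for x :: 'a
  proof -
    have "(\<lambda>n. x * (1 / of_nat n) + 1) \<longlonglongrightarrow> x * 0 + 1"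
      by (intro tendsto_intros lim_1_over_n)
    moreover have "\<forall>\<^sub>F n in sequentially. x * (1 / of_nat n) + 1 = (x + of_nat n) / of_nat n"
      using eventually_gt_at_top[of 0] by eventually_elim (simp add: field_simps)
    ultimately show ?thesis by (simp add: tendsto_cong)
  qed
  have "(\<lambda>n. (((1 + of_nat n) / of_nat n) * ((c + of_nat n) / of_nat n)) /
     (((a + of_nat n) / of_nat n) * ((b + of_nat n) / of_nat n))) \<longlonglongrightarrow> (1 * 1) / (1 * 1)"
    by (intro tendsto_intros lin) auto
  moreover have "\<forall>\<^sub>F n in sequentially. (((1 + of_nat n) / of_nat n) * ((c + of_nat n) / of_nat n)) /
     (((a + of_nat n) / of_nat n) * ((b + of_nat n) / of_nat n)) = h n / h (Suc n)"
    using eventually_gt_at_top[of 0] by eventually_elim (simp add: q)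
  ultimately have "(\<lambda>n. h n / h (Suc n)) \<longlonglongrightarrow> 1" by (simp add: tendsto_cong)
  hence "(\<lambda>n. norm (h n) / norm (h (Suc n))) \<longlonglongrightarrow> 1"
    by (metis (no_types, lifting) norm_divide norm_one tendsto_norm filterlim_cong LIMSEQ_unique ext)
  hence "conv_radius h = 1"
    by (intro conv_radius_ratio_limit_nonzero[of _ 1]) (simp_all add: one_ereal_def)
  thus ?thesis by (simp add: fps_conv_radius_def h_def[abs_def] del: fps_hypergeo_nth)
qed

lemma hyp2F1_commute: "hyp2F1 a b c z = hyp2F1 b a c z"
  by (simp add: hyp2F1_def fps_hypergeo_def mult.commute)

lemma hyp2F1_0 [simp]: "hyp2F1 a b c 0 = 1"
  by (simp add: hyp2F1_def eval_fps_at_0)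

lemma in_conv_ball_hypergeo_21:
  fixes a b c :: "'a :: {banach, real_normed_field}"
  assumes "norm z < 1"
  shows "ereal (norm z) < fps_conv_radius (fps_hypergeo [a, b] [c] 1)"
proof -
  have "ereal (norm z) < 1" using assms by simp
  also note fps_conv_radius_hypergeo_21
  finally show ?thesis .
qed

lemma pochhammer_shift:
  fixes a :: "'a :: field_char_0"
  shows "a * pochhammer (a + 1) n = pochhammer a n * (a + of_nat n)"
  by (metis pochhammer_Suc pochhammer_rec)

lemma fps_deriv_hypergeo_21:
  fixes a b c :: "'a :: field_char_0"
  shows "fps_deriv (fps_hypergeo [a, b] [c] 1) =
          fps_const (a * b / c) * fps_hypergeo [a + 1, b + 1] [c + 1] 1"
proof (rule fps_ext)
  fix n
  have nz: "(1 + of_nat n :: 'a) \<noteq> 0" by (metis of_nat_Suc of_nat_neq_0)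
  have "fact n + of_nat n * fact n = fact n * (1 + of_nat n :: 'a)"
    by (simp add: algebra_simps)
  with nz have "fact n + of_nat n * fact n \<noteq> (0 :: 'a)" by simp
  with nz show "fps_nth (fps_deriv (fps_hypergeo [a, b] [c] 1)) n =
          fps_nth (fps_const (a * b / c) * fps_hypergeo [a + 1, b + 1] [c + 1] 1) n"
    by (simp add: pochhammer_rec divide_simps) (simp add: algebra_simps)
qed

lemma eval_fps_deriv_hypergeo_21:
  fixes a b c :: "'a :: {banach, real_normed_field}"
  assumes "norm z < 1"
  shows "eval_fps (fps_deriv (fps_hypergeo [a, b] [c] 1)) z =
           a * b / c * hyp2F1 (a + 1) (b + 1) (c + 1) z"
  unfolding fps_deriv_hypergeo_21 hyp2F1_def
  using in_conv_ball_hypergeo_21[OF assms, of "a+1" "b+1" "c+1"] by (subst eval_fps_mult) auto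

lemma has_field_derivative_hyp2F1:
  fixes a b c :: "'a :: {banach, real_normed_field}"
  assumes "norm z < 1"
  shows "(hyp2F1 a b c has_field_derivative a * b / c * hyp2F1 (a + 1) (b + 1) (c + 1) z) (at z)"
  using has_field_derivative_eval_fps[OF in_conv_ball_hypergeo_21[OF assms, of a b c], of UNIV]
  by (simp add: hyp2F1_def[abs_def] eval_fps_deriv_hypergeo_21[OF assms])

lemma eval_fps_linear_combination:
  fixes f g h :: "'a :: {banach, real_normed_field} fps"
  assumes "fps_X * f + fps_const d * g = fps_const d * h"
    and "norm z < fps_conv_radius f" "norm z < fps_conv_radius g" "norm z < fps_conv_radius h"
  shows "z * eval_fps f z + d * eval_fps g z = d * eval_fps h z"
proof -
  have "norm z < fps_conv_radius (fps_X * f)" "norm z < fps_conv_radius (fps_const d * g)"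
    by (rule less_le_trans[OF _ fps_conv_radius_mult]; use assms in simp)+
  then show ?thesis
    using arg_cong[OF assms(1), of "\<lambda>f. eval_fps f z"] assms(2-)
    by (simp add: eval_fps_add eval_fps_mult)
qed

text \<open>The operator z d/dz + a multiplies the n-th coefficient by a + n, and (a)_n (a + n) = a
  (a + 1)_n.\<close>

lemma hyp2F1_shift_upper:
  fixes a b c :: "'a :: {banach, real_normed_field}"
  assumes "norm z < 1"
  shows "z * (a * b / c * hyp2F1 (a + 1) (b + 1) (c + 1) z) + a * hyp2F1 a b c z =
           a * hyp2F1 (a + 1) b c z"
proof -
  have co: "of_nat n * (pochhammer a n * q / w) + a * (pochhammer a n * q / w) =
            a * (pochhammer (a + 1) n * q / w)" for n and q w :: 'a
  proof -
    have "of_nat n * (pochhammer a n * q / w) + a * (pochhammer a n * q / w) =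
            (pochhammer a n * (a + of_nat n)) * q / w"
      by (simp add: algebra_simps add_divide_distrib)
    thus ?thesis by (simp add: pochhammer_shift[symmetric])
  qed
  have "fps_X * fps_deriv (fps_hypergeo [a, b] [c] 1) +
              fps_const a * fps_hypergeo [a, b] [c] 1 = fps_const a * fps_hypergeo [a + 1, b] [c] 1"
    by (rule fps_ext, rename_tac n, case_tac n) (use co in \<open>auto simp del: of_nat_Suc\<close>)
  from eval_fps_linear_combination[OF this
      less_le_trans[OF in_conv_ball_hypergeo_21 fps_conv_radius_deriv]
      in_conv_ball_hypergeo_21 in_conv_ball_hypergeo_21] assms
  show ?thesis by (simp add: eval_fps_deriv_hypergeo_21 hyp2F1_def)
qed

text \<open>The same argument for z d/dz + c - 1, with (c - 1 + n) / (c)_n = (c - 1) / (c -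
  1)_n.\<close>

lemma hyp2F1_shift_lower:
  fixes a b c :: "'a :: {banach, real_normed_field}"
  assumes "norm z < 1" "c \<notin> \<int>\<^sub>\<le>\<^sub>0" "c - 1 \<notin> \<int>\<^sub>\<le>\<^sub>0"
  shows "z * (a * b / c * hyp2F1 (a + 1) (b + 1) (c + 1) z) + (c - 1) * hyp2F1 a b c z =
           (c - 1) * hyp2F1 a b (c - 1) z"
proof -
  have nz: "pochhammer c n \<noteq> 0" "pochhammer (c - 1) n \<noteq> 0" for n
    using assms(2,3) by (auto simp: pochhammer_eq_0_iff)
  have co: "of_nat n * (q / (pochhammer c n * w)) + (c - 1) * (q / (pochhammer c n * w)) =
            (c - 1) * (q / (pochhammer (c - 1) n * w))" for n and q w :: 'a
  proof -
    have "(c - 1) / pochhammer (c - 1) n = (c - 1 + of_nat n) / pochhammer c n"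
      using pochhammer_shift[of "c - 1" n] nz[of n] by (simp add: divide_simps mult.commute)
    moreover have "of_nat n * (q / (pochhammer c n * w)) + (c - 1) * (q / (pochhammer c n * w)) =
            (c - 1 + of_nat n) / pochhammer c n * (q / w)"
      by (simp only: times_divide_times_eq times_divide_eq_right add_divide_distrib[symmetric])
         (simp add: algebra_simps)
    ultimately show ?thesis by (metis times_divide_times_eq times_divide_eq_right)
  qed
  have "fps_X * fps_deriv (fps_hypergeo [a, b] [c] 1) +
          fps_const (c - 1) * fps_hypergeo [a, b] [c] 1 = fps_const (c - 1) * fps_hypergeo [a, b] [c - 1] 1"
    by (rule fps_ext, rename_tac n, case_tac n) (use co in \<open>auto simp del: of_nat_Suc fact_Suc\<close>)
  from eval_fps_linear_combination[OF this
      less_le_trans[OF in_conv_ball_hypergeo_21 fps_conv_radius_deriv]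
      in_conv_ball_hypergeo_21 in_conv_ball_hypergeo_21] assms(1)
  show ?thesis by (simp add: eval_fps_deriv_hypergeo_21 hyp2F1_def)
qed

subsection \<open>Contiguous families of Legendre type\<close>

text \<open>These are the upper parameters in \<open>legendre_Qhat\<close>, with
  \<open>s = \<nu> + \<mu> + 1\<close>. As they differ by 1/2, raising \<open>s / 2\<close> by one
  and exchanging the two gives those of \<open>s + 1\<close>. Contiguity in a single upper parameter
  is thus a unit step in \<open>s\<close>.\<close>

definition legendre_2F1 :: "real \<Rightarrow> real \<Rightarrow> real \<Rightarrow> real" where
  "legendre_2F1 s c x = hyp2F1 (s / 2) (s / 2 + 1 / 2) c x"

lemma legendre_2F1_0 [simp]: "legendre_2F1 s c 0 = 1"
  by (simp add: legendre_2F1_def)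

lemma has_field_derivative_legendre_2F1:
  assumes "\<bar>x\<bar> < 1"
  shows "(legendre_2F1 s c has_field_derivative s * (s + 1) / (4 * c) * legendre_2F1 (s + 2) (c + 1) x) (at x)"
proof -
  have e: "s / 2 + 1 / 2 + 1 = (s + 2) / 2 + 1 / 2" "s / 2 + 1 = (s + 2) / 2"
    and f: "s / 2 * (s / 2 + 1 / 2) / c = s * (s + 1) / (4 * c)"
    by (simp_all add: field_simps)
  from assms have "norm x < 1" by simp
  from has_field_derivative_hyp2F1[OF this, of "s / 2" "s / 2 + 1 / 2" c] show ?thesis
    unfolding legendre_2F1_def[abs_def] e f .
qed

lemma legendre_2F1_shift_upper:
  assumes "\<bar>x\<bar> < 1"
  shows "x * (2 * (s * (s + 1) / (4 * c) * legendre_2F1 (s + 2) (c + 1) x)) + s * legendre_2F1 s c x =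
           s * legendre_2F1 (s + 1) c x"
proof -
  have e: "s / 2 + 1 / 2 + 1 = (s + 2) / 2 + 1 / 2" "s / 2 + 1 = (s + 2) / 2"
    and f: "s / 2 * (s / 2 + 1 / 2) / c = s * (s + 1) / (4 * c)"
    and g: "(s + 2) / 2 = (s + 1) / 2 + 1 / 2" "s / 2 + 1 / 2 = (s + 1) / 2"
    by (simp_all add: field_simps)
  define D where "D = s * (s + 1) / (4 * c) * legendre_2F1 (s + 2) (c + 1) x"
  from assms have "norm x < 1" by simp
  from hyp2F1_shift_upper[OF this, of "s / 2" "s / 2 + 1 / 2" c]
  have "x * D + s / 2 * legendre_2F1 s c x = s / 2 * hyp2F1 ((s + 2) / 2) (s / 2 + 1 / 2) c x"
    unfolding legendre_2F1_def e f D_def .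
  also have "hyp2F1 ((s + 2) / 2) (s / 2 + 1 / 2) c x = legendre_2F1 (s + 1) c x"
    unfolding legendre_2F1_def g by (rule hyp2F1_commute)
  finally show ?thesis unfolding D_def[symmetric] by (simp add: field_simps)
qed

lemma legendre_2F1_shift_lower:
  assumes "\<bar>x\<bar> < 1" "c \<notin> \<int>"
  shows "x * (s * (s + 1) / (4 * c) * legendre_2F1 (s + 2) (c + 1) x) + (c - 1) * legendre_2F1 s c x =
           (c - 1) * legendre_2F1 s (c - 1) x"
proof -
  have e: "s / 2 + 1 / 2 + 1 = (s + 2) / 2 + 1 / 2" "s / 2 + 1 = (s + 2) / 2"
    and f: "s / 2 * (s / 2 + 1 / 2) / c = s * (s + 1) / (4 * c)"
    by (simp_all add: field_simps)
  have "c - 1 \<notin> \<int>" using assms(2) by (metis Ints_1 Ints_add diff_add_cancel)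
  with assms have "norm x < 1" "c \<notin> \<int>\<^sub>\<le>\<^sub>0" "c - 1 \<notin> \<int>\<^sub>\<le>\<^sub>0"
    using nonpos_Ints_Int by auto
  from hyp2F1_shift_lower[OF this, of "s / 2" "s / 2 + 1 / 2"] show ?thesis
    unfolding legendre_2F1_def e f .
qed

text \<open>
  Normalized by Gamma functions, the Frobenius solutions \<open>\<Phi>\<^sub>1\<close> and \<open>\<Phi>\<^sub>2\<close> at \<open>0\<close> are both the sum of
  \<open>\<Gamma>(s + 2j) / (4\<^sup>j \<Gamma>(c + j) \<Gamma>(1 + j)) x\<^sup>j\<close>, over \<open>j \<in> \<nat>\<close> and over \<open>j \<in> 1 - c + \<nat>\<close> respectively. This is why
  they obey the same contiguity relations, with the same constants.
\<close>

definition ladder_family :: "(real \<Rightarrow> real \<Rightarrow> real \<Rightarrow> real) \<Rightarrow> bool" where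
  "ladder_family \<Phi> \<longleftrightarrow> (\<forall>s c x. s \<notin> \<int> \<and> c \<notin> \<int> \<and> s - 2 * c \<notin> \<int> \<and> 0 < x \<and> x < 1 \<longrightarrow>
     (\<Phi> s c has_field_derivative \<Phi> (s + 2) (c + 1) x / 4) (at x) \<and>
     x * \<Phi> (s + 2) (c + 1) x / 2 + s * \<Phi> s c x = \<Phi> (s + 1) c x \<and>
     x * \<Phi> (s + 2) (c + 1) x / 4 + (c - 1) * \<Phi> s c x = \<Phi> s (c - 1) x)"

definition \<Phi>\<^sub>1 :: "real \<Rightarrow> real \<Rightarrow> real \<Rightarrow> real" where
  "\<Phi>\<^sub>1 s c x = Gamma s / Gamma c * legendre_2F1 s c x"

definition \<Phi>\<^sub>2 :: "real \<Rightarrow> real \<Rightarrow> real \<Rightarrow> real" where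
  "\<Phi>\<^sub>2 s c x = 4 powr (c - 1) * Gamma (s + 2 - 2 * c) / Gamma (2 - c) * x powr (1 - c) *
     legendre_2F1 (s + 2 - 2 * c) (2 - c) x"

lemma Gamma_plus1_notin_Ints: "s \<notin> \<int> \<Longrightarrow> Gamma (s + 1) = s * Gamma (s :: real)"
  using nonpos_Ints_Int by (intro Gamma_plus1) auto

lemma Gamma_neq_0_notin_Ints: "s \<notin> \<int> \<Longrightarrow> Gamma (s :: real) \<noteq> 0"
  using nonpos_Ints_Int by (auto simp: Gamma_eq_zero_iff)

lemma ladder_family_\<Phi>\<^sub>1: "ladder_family \<Phi>\<^sub>1"
  unfolding ladder_family_def
proof (intro allI impI; elim conjE)
  fix s c x :: real
  assume H: "s \<notin> \<int>" "c \<notin> \<int>" "s - 2 * c \<notin> \<int>" "0 < x" "x < 1"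
  hence ax: "\<bar>x\<bar> < 1" and c0: "c \<noteq> 0" by auto
  have s1: "s + 1 \<notin> \<int>" and c1: "c - 1 \<notin> \<int>"
    using H by (metis Ints_1 Ints_add Ints_diff add_diff_cancel_right' diff_add_cancel)+
  have Gs1: "Gamma (s + 1) = s * Gamma s"
    using H by (intro Gamma_plus1_notin_Ints)
  have Gs: "Gamma (s + 2) = (s + 1) * s * Gamma s"
    using Gamma_plus1_notin_Ints[OF s1] Gs1 by (simp add: add.assoc)
  have Gc: "Gamma (c + 1) = c * Gamma c" "Gamma c = (c - 1) * Gamma (c - 1)"
    using Gamma_plus1_notin_Ints[OF H(2)] Gamma_plus1_notin_Ints[OF c1] by simp_all
  have nz: "Gamma c \<noteq> 0" using H by (intro Gamma_neq_0_notin_Ints)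
  define D where "D = s * (s + 1) / (4 * c) * legendre_2F1 (s + 2) (c + 1) x"
  have A: "x * (2 * D) + s * legendre_2F1 s c x = s * legendre_2F1 (s + 1) c x"
    using legendre_2F1_shift_upper[OF ax, of s c] by (simp add: D_def)
  have B: "x * D + (c - 1) * legendre_2F1 s c x = (c - 1) * legendre_2F1 s (c - 1) x"
    using legendre_2F1_shift_lower[OF ax H(2), of s] by (simp add: D_def)
  have p: "\<Phi>\<^sub>1 (s + 2) (c + 1) x = 4 * (Gamma s / Gamma c) * D"
    unfolding \<Phi>\<^sub>1_def Gs Gc(1) D_def by (simp add: mult_ac)
  show "(\<Phi>\<^sub>1 s c has_field_derivative \<Phi>\<^sub>1 (s + 2) (c + 1) x / 4) (at x) \<and>
        x * \<Phi>\<^sub>1 (s + 2) (c + 1) x / 2 + s * \<Phi>\<^sub>1 s c x = \<Phi>\<^sub>1 (s + 1) c x \<and>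
        x * \<Phi>\<^sub>1 (s + 2) (c + 1) x / 4 + (c - 1) * \<Phi>\<^sub>1 s c x = \<Phi>\<^sub>1 s (c - 1) x"
  proof (intro conjI)
    show "(\<Phi>\<^sub>1 s c has_field_derivative \<Phi>\<^sub>1 (s + 2) (c + 1) x / 4) (at x)"
      unfolding p unfolding \<Phi>\<^sub>1_def[abs_def] D_def
      by (rule DERIV_cong[OF DERIV_cmult[OF has_field_derivative_legendre_2F1[OF ax]]]) simp
    have "x * \<Phi>\<^sub>1 (s + 2) (c + 1) x / 2 + s * \<Phi>\<^sub>1 s c x =
        Gamma s / Gamma c * (x * (2 * D) + s * legendre_2F1 s c x)"
      unfolding p unfolding \<Phi>\<^sub>1_def using nz by (simp add: field_simps)
    also have "\<dots> = \<Phi>\<^sub>1 (s + 1) c x"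
      unfolding A \<Phi>\<^sub>1_def Gs1 by simp
    finally show "x * \<Phi>\<^sub>1 (s + 2) (c + 1) x / 2 + s * \<Phi>\<^sub>1 s c x = \<Phi>\<^sub>1 (s + 1) c x" .
    have "x * \<Phi>\<^sub>1 (s + 2) (c + 1) x / 4 + (c - 1) * \<Phi>\<^sub>1 s c x =
        Gamma s / Gamma c * (x * D + (c - 1) * legendre_2F1 s c x)"
      unfolding p unfolding \<Phi>\<^sub>1_def using nz by (simp add: field_simps)
    also have "\<dots> = \<Phi>\<^sub>1 s (c - 1) x"
      unfolding B \<Phi>\<^sub>1_def Gc(2) using c1 by auto
    finally show "x * \<Phi>\<^sub>1 (s + 2) (c + 1) x / 4 + (c - 1) * \<Phi>\<^sub>1 s c x = \<Phi>\<^sub>1 s (c - 1) x" .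
  qed
qed

text \<open>In terms of \<open>s' = s + 2 - 2 * c\<close> and \<open>c' = 2 - c\<close>, the step
  from \<open>(s, c)\<close> to \<open>(s + 2, c + 1)\<close> lowers \<open>c'\<close> alone, and
  the step from \<open>c\<close> to \<open>c - 1\<close> raises \<open>(s', c')\<close> by
  \<open>(2, 1)\<close>. Hence two relations change roles: the derivative of the family uses the
  lowering of \<open>c'\<close>, and the lowering of \<open>c\<close> uses the derivative of the
  series. The power \<open>x powr (1 - c)\<close> shifts x d/dx by \<open>1 - c\<close>, which
  accounts for the coefficients.\<close>

lemma ladder_family_\<Phi>\<^sub>2: "ladder_family \<Phi>\<^sub>2"
  unfolding ladder_family_def
proof (intro allI impI; elim conjE)
  fix s c x :: real
  assume H: "s \<notin> \<int>" "c \<notin> \<int>" "s - 2 * c \<notin> \<int>" "0 < x" "x < 1"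
  hence ax: "\<bar>x\<bar> < 1" by auto
  define s' where "s' = s + 2 - 2 * c"
  define c' where "c' = 2 - c"
  define k where "k = 4 powr (c - 1) * Gamma s' / Gamma c'"
  define D where "D = s' * (s' + 1) / (4 * c') * legendre_2F1 (s' + 2) (c' + 1) x"
  have s'0: "s' \<notin> \<int>"
    using Ints_diff[of "s + 2 - 2 * c" 2] H unfolding s'_def by (auto simp: algebra_simps)
  have c'0: "c' \<notin> \<int>"
    using Ints_diff[of 2 "2 - c"] H unfolding c'_def by auto
  have s'1: "s' + 1 \<notin> \<int>" and c'1: "c' - 1 \<notin> \<int>"
    using s'0 c'0 by (metis Ints_1 Ints_add Ints_diff add_diff_cancel_right' diff_add_cancel)+
  have Gs1: "Gamma (s' + 1) = s' * Gamma s'"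
    using s'0 by (intro Gamma_plus1_notin_Ints)
  have Gs: "Gamma (s' + 2) = (s' + 1) * s' * Gamma s'"
    using Gamma_plus1_notin_Ints[OF s'1] Gs1 by (simp add: add.assoc)
  have Gc: "Gamma (c' + 1) = c' * Gamma c'" "Gamma c' = (c' - 1) * Gamma (c' - 1)"
    using Gamma_plus1_notin_Ints[OF c'0] Gamma_plus1_notin_Ints[OF c'1] by simp_all
  have nz: "Gamma c' \<noteq> 0" "Gamma (c' - 1) \<noteq> 0" "c' - 1 \<noteq> 0" "c' \<noteq> 0"
    using c'0 c'1 Gamma_neq_0_notin_Ints by auto
  have pw1: "x powr (1 - c) = x * x powr (- c)"
    using H powr_add[of x 1 "- c"] by simp
  have pw2: "4 powr c = 4 * 4 powr (c - 1)"
    using powr_add[of 4 1 "c - 1"] by simp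
  have pw3: "4 powr (c - 2) * 4 = 4 powr (c - 1)"
    using powr_add[of 4 "c - 2" 1] by simp
  note pw = pw1 pw2
  have A: "x * (2 * D) + s' * legendre_2F1 s' c' x = s' * legendre_2F1 (s' + 1) c' x"
    using legendre_2F1_shift_upper[OF ax, of s' c'] by (simp add: D_def)
  have B: "x * D + (c' - 1) * legendre_2F1 s' c' x = (c' - 1) * legendre_2F1 s' (c' - 1) x"
    using legendre_2F1_shift_lower[OF ax c'0, of s'] by (simp add: D_def)
  have p0: "\<Phi>\<^sub>2 s c = (\<lambda>x. k * (x powr (1 - c) * legendre_2F1 s' c' x))"
    by (auto simp: \<Phi>\<^sub>2_def k_def s'_def c'_def fun_eq_iff)
  have e: "s + 2 + 2 - 2 * (c + 1) = s'" "2 - (c + 1) = c' - 1" "c + 1 - 1 = c" "1 - (c + 1) = - c"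
    by (simp_all add: s'_def c'_def)
  have p: "\<Phi>\<^sub>2 (s + 2) (c + 1) x = 4 * k * (x powr (- c) * (x * D + (c' - 1) * legendre_2F1 s' c' x))"
    unfolding \<Phi>\<^sub>2_def e B k_def pw Gc(2) using nz by simp
  have q: "1 - c = c' - 1" by (simp add: c'_def)
  show "(\<Phi>\<^sub>2 s c has_field_derivative \<Phi>\<^sub>2 (s + 2) (c + 1) x / 4) (at x) \<and>
        x * \<Phi>\<^sub>2 (s + 2) (c + 1) x / 2 + s * \<Phi>\<^sub>2 s c x = \<Phi>\<^sub>2 (s + 1) c x \<and>
        x * \<Phi>\<^sub>2 (s + 2) (c + 1) x / 4 + (c - 1) * \<Phi>\<^sub>2 s c x = \<Phi>\<^sub>2 s (c - 1) x"
  proof (intro conjI)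
    have "((\<lambda>x. x powr (1 - c)) has_field_derivative (1 - c) * x powr (- c)) (at x)"
      using has_real_derivative_powr[OF H(4), of "1 - c"] by simp
    from DERIV_cmult[OF DERIV_mult[OF this has_field_derivative_legendre_2F1[OF ax, of s' c']], of k]
    show "(\<Phi>\<^sub>2 s c has_field_derivative \<Phi>\<^sub>2 (s + 2) (c + 1) x / 4) (at x)"
      unfolding p0 p D_def[symmetric]
      by (rule DERIV_cong) (simp add: pw1[unfolded q] q algebra_simps)
    have e2: "s + 1 + 2 - 2 * c = s' + 1" "2 - c = c'"
      by (simp_all add: s'_def c'_def)
    have s: "s = s' - 2 * (1 - c)" by (simp add: s'_def)
    have "x * \<Phi>\<^sub>2 (s + 2) (c + 1) x / 2 + s * \<Phi>\<^sub>2 s c x =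
      k * x powr (1 - c) * (x * (2 * D) + s' * legendre_2F1 s' c' x)"
      unfolding p p0 unfolding pw q[symmetric] by (subst s) (simp add: field_simps)
    also have "\<dots> = \<Phi>\<^sub>2 (s + 1) c x"
      unfolding A \<Phi>\<^sub>2_def e2 Gs1 k_def by simp
    finally show "x * \<Phi>\<^sub>2 (s + 2) (c + 1) x / 2 + s * \<Phi>\<^sub>2 s c x = \<Phi>\<^sub>2 (s + 1) c x" .
    have e3: "s + 2 - 2 * (c - 1) = s' + 2" "2 - (c - 1) = c' + 1" "1 - (c - 1) = 1 + (1 - c)" "c - 1 - 1 = c - 2"
      by (simp_all add: s'_def c'_def)
    have "x * \<Phi>\<^sub>2 (s + 2) (c + 1) x / 4 + (c - 1) * \<Phi>\<^sub>2 s c x = k * x powr (1 - c) * (x * D)"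
      unfolding p p0 unfolding pw q[symmetric] by (simp add: field_simps)
    also have "\<dots> = \<Phi>\<^sub>2 s (c - 1) x"
      unfolding \<Phi>\<^sub>2_def e3 D_def Gs Gc(1) k_def powr_add
      using nz H by (simp add: pw3[symmetric] mult_ac)
    finally show "x * \<Phi>\<^sub>2 (s + 2) (c + 1) x / 4 + (c - 1) * \<Phi>\<^sub>2 s c x = \<Phi>\<^sub>2 s (c - 1) x" .
  qed
qed

subsection \<open>Rationality along the lattice of parameters\<close>

text \<open>One pair of polynomials serves all of \<open>S\<close>, even if \<open>S\<close> is
  disconnected. On \<open>oct_S\<close> this ties the values at \<open>u < - 1\<close> to those near
  \<open>0\<close>.\<close>

definition rational_on :: "real set \<Rightarrow> (real \<Rightarrow> real) \<Rightarrow> bool" where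
  "rational_on S f \<longleftrightarrow> (\<exists>p q. \<forall>u\<in>S. poly q u \<noteq> 0 \<and> f u = poly p u / poly q u)"

lemma rational_onE:
  assumes "rational_on S f"
  obtains p q where "\<And>u. u \<in> S \<Longrightarrow> poly q u \<noteq> 0" "\<And>u. u \<in> S \<Longrightarrow> f u = poly p u / poly q u"
  using assms unfolding rational_on_def by metis

lemma rational_onI:
  assumes "\<And>u. u \<in> S \<Longrightarrow> poly q u \<noteq> 0" "\<And>u. u \<in> S \<Longrightarrow> f u = poly p u / poly q u"
  shows "rational_on S f"
  using assms unfolding rational_on_def by metis

lemma rational_on_cong:
  assumes "\<And>u. u \<in> S \<Longrightarrow> f u = g u"
  shows "rational_on S f \<longleftrightarrow> rational_on S g"
  using assms unfolding rational_on_def by auto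

lemma rational_on_poly: "rational_on S (\<lambda>u. poly p u)"
  by (rule rational_onI[where q = 1 and p = p]) auto

lemma rational_on_const: "rational_on S (\<lambda>u. a)"
  using rational_on_poly[of S "[:a:]"] by simp

lemma rational_on_add:
  assumes "rational_on S f" "rational_on S g"
  shows "rational_on S (\<lambda>u. f u + g u)"
proof -
  from assms obtain p q p' q' where
    "\<And>u. u \<in> S \<Longrightarrow> poly q u \<noteq> 0" "\<And>u. u \<in> S \<Longrightarrow> f u = poly p u / poly q u"
    "\<And>u. u \<in> S \<Longrightarrow> poly q' u \<noteq> 0" "\<And>u. u \<in> S \<Longrightarrow> g u = poly p' u / poly q' u"
    by (metis rational_onE)
  thus ?thesis
    by (intro rational_onI[where q = "q * q'" and p = "p * q' + p' * q"]) (simp_all add: add_frac_eq)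
qed

lemma rational_on_mult:
  assumes "rational_on S f" "rational_on S g"
  shows "rational_on S (\<lambda>u. f u * g u)"
proof -
  from assms obtain p q p' q' where
    "\<And>u. u \<in> S \<Longrightarrow> poly q u \<noteq> 0" "\<And>u. u \<in> S \<Longrightarrow> f u = poly p u / poly q u"
    "\<And>u. u \<in> S \<Longrightarrow> poly q' u \<noteq> 0" "\<And>u. u \<in> S \<Longrightarrow> g u = poly p' u / poly q' u"
    by (metis rational_onE)
  thus ?thesis
    by (intro rational_onI[where q = "q * q'" and p = "p * p'"]) simp_all
qed

lemma rational_on_divide:
  assumes "rational_on S f" "rational_on S g" "\<And>u. u \<in> S \<Longrightarrow> g u \<noteq> 0"
  shows "rational_on S (\<lambda>u. f u / g u)"
proof -
  from assms obtain p q p' q' where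
    *: "\<And>u. u \<in> S \<Longrightarrow> poly q u \<noteq> 0" "\<And>u. u \<in> S \<Longrightarrow> f u = poly p u / poly q u"
    "\<And>u. u \<in> S \<Longrightarrow> poly q' u \<noteq> 0" "\<And>u. u \<in> S \<Longrightarrow> g u = poly p' u / poly q' u"
    by (metis rational_onE)
  with assms(3) have "\<And>u. u \<in> S \<Longrightarrow> poly p' u \<noteq> 0" by fastforce
  with * show ?thesis
    by (intro rational_onI[where q = "q * p'" and p = "p * q'"]) simp_all
qed

lemma rational_on_diff:
  assumes "rational_on S f" "rational_on S g"
  shows "rational_on S (\<lambda>u. f u - g u)"
  using rational_on_add[OF assms(1) rational_on_mult[OF rational_on_const[of S "-1"] assms(2)]] by simp

lemma rational_on_deriv:
  assumes "rational_on S f" "open S" "\<And>u. u \<in> S \<Longrightarrow> (f has_field_derivative f' u) (at u)"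
  shows "rational_on S f'"
proof -
  from assms obtain p q where
    *: "\<And>u. u \<in> S \<Longrightarrow> poly q u \<noteq> 0" "\<And>u. u \<in> S \<Longrightarrow> f u = poly p u / poly q u"
    by (metis rational_onE)
  have "f' u = poly (pderiv p * q - p * pderiv q) u / poly (q * q) u" if "u \<in> S" for u
  proof -
    have "((\<lambda>u. poly p u / poly q u) has_field_derivative
            (poly (pderiv p) u * poly q u - poly p u * poly (pderiv q) u) / (poly q u * poly q u)) (at u)"
      by (intro DERIV_divide poly_DERIV * that)
    moreover have "((\<lambda>u. poly p u / poly q u) has_field_derivative f' u) (at u)"
      by (rule has_field_derivative_transform_within_open[OF assms(3)[OF that] assms(2) that]) (use * in auto)
    ultimately show ?thesis by (auto dest: DERIV_unique)
  qed
  with * show ?thesis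
    by (intro rational_onI[where q = "q * q" and p = "pderiv p * q - p * pderiv q"]) auto
qed

section \<open>The octahedral polynomials and their covering on the real line\<close>

definition oct_e :: "real \<Rightarrow> real" where "oct_e u = (1 + u) * (1 - 34 * u + u\<^sup>2)"
definition oct_f :: "real \<Rightarrow> real" where "oct_f u = 1 + 14 * u + u\<^sup>2"
definition oct_v :: "real \<Rightarrow> real" where "oct_v u = u * (1 - u) ^ 4"
definition oct_R :: "real \<Rightarrow> real" where "oct_R u = - 108 * oct_v u / (oct_e u)\<^sup>2"
text \<open>
  On \<open>oct_S\<close> the covering \<open>oct_R\<close> takes values in \<open>(0, 1)\<close>. The set has two components, separated by
  \<open>- 1\<close> and exchanged by \<open>u \<mapsto> 1 / u\<close>, under which \<open>oct_R\<close> is invariant.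
\<close>

definition oct_S :: "real set" where "oct_S = {u. u < 0 \<and> 0 < oct_f u}"

text \<open>The syzygy between the vertex, edge and face polynomials. Divided by the square of
  \<open>oct_e u\<close> it gives \<open>1 - oct_R u\<close>, so that \<open>oct_R u < 1\<close>
  amounts to \<open>oct_f u > 0\<close>.\<close>

lemma oct_identity: "- 108 * oct_v u = (oct_e u)\<^sup>2 - oct_f u ^ 3"
  unfolding oct_v_def oct_e_def oct_f_def by algebra

lemma open_oct_S: "open oct_S"
  unfolding oct_S_def oct_f_def
  by (intro open_Collect_conj open_Collect_less continuous_intros)

lemma oct_SD:
  assumes "u \<in> oct_S"
  shows "u < 0" "oct_f u > 0" "oct_v u < 0" "oct_e u \<noteq> 0" "u \<noteq> -1" "oct_e u > 0 \<longleftrightarrow> u > -1"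
proof -
  show u: "u < 0" "oct_f u > 0" using assms by (auto simp: oct_S_def)
  show "oct_v u < 0" using u unfolding oct_v_def by (intro mult_neg_pos) auto
  show m: "u \<noteq> -1" using u by (auto simp: oct_f_def)
  have "0 < 1 - 34 * u + u\<^sup>2" using u by (smt (verit) zero_le_power2)
  thus "oct_e u \<noteq> 0" "oct_e u > 0 \<longleftrightarrow> u > -1"
    using m by (auto simp: oct_e_def zero_less_mult_iff)
qed

lemma oct_R_bounds:
  assumes "u \<in> oct_S"
  shows "0 < oct_R u" "oct_R u < 1"
proof -
  note u = oct_SD[OF assms]
  have "- 108 * oct_v u > 0" "(oct_e u)\<^sup>2 > 0" "oct_f u ^ 3 > 0" using u by auto
  thus "0 < oct_R u" "oct_R u < 1" using oct_identity[of u] by (simp_all add: oct_R_def divide_simps)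
qed

lemma has_field_derivative_oct_e:
  "(oct_e has_field_derivative (- 33 - 66 * u + 3 * u\<^sup>2)) (at u)"
  unfolding oct_e_def[abs_def]
  by (auto intro!: derivative_eq_intros simp: power2_eq_square algebra_simps)

text \<open>In lowest terms the derivative is
  \<open>- 108 * (1 - u) ^ 3 * (oct_f u)\<^sup>2 / oct_e u ^ 3\<close>. This is the branching of the
  covering: order 4 at \<open>u = 1\<close>, order 3 at the zeros of \<open>oct_f\<close>, order 2
  at the zeros of \<open>oct_e\<close>. The factor \<open>oct_R u\<close> is split off because the
  ladder relations contain x d/dx.\<close>

lemma has_field_derivative_oct_R:
  assumes "oct_e u \<noteq> 0" "u \<noteq> 0" "u \<noteq> 1"
  shows "(oct_R has_field_derivative oct_R u * (oct_f u)\<^sup>2 / (u * (1 - u) * oct_e u)) (at u)"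
proof -
  have v: "((\<lambda>u. - 108 * oct_v u) has_field_derivative - 108 * ((1 - u) ^ 4 - 4 * u * (1 - u) ^ 3)) (at u)"
    unfolding oct_v_def[abs_def] by (auto intro!: derivative_eq_intros)
  have "(oct_R has_field_derivative
     ((- 108 * ((1 - u) ^ 4 - 4 * u * (1 - u) ^ 3)) * (oct_e u)\<^sup>2 -
       (- 108 * oct_v u) * (2 * (oct_e u * (- 33 - 66 * u + 3 * u\<^sup>2)))) / ((oct_e u)\<^sup>2 * (oct_e u)\<^sup>2)) (at u)"
    unfolding oct_R_def[abs_def]
    by (rule DERIV_divide[OF v]) (use assms has_field_derivative_oct_e in \<open>auto intro!: derivative_eq_intros\<close>)
  also have "((- 108 * ((1 - u) ^ 4 - 4 * u * (1 - u) ^ 3)) * (oct_e u)\<^sup>2 -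
       (- 108 * oct_v u) * (2 * (oct_e u * (- 33 - 66 * u + 3 * u\<^sup>2)))) =
       - 108 * (1 - u) ^ 3 * (oct_f u)\<^sup>2 * oct_e u"
    unfolding oct_e_def oct_f_def oct_v_def by algebra
  also have "- 108 * (1 - u) ^ 3 * (oct_f u)\<^sup>2 * oct_e u / ((oct_e u)\<^sup>2 * (oct_e u)\<^sup>2) =
      oct_R u * (oct_f u)\<^sup>2 / (u * (1 - u) * oct_e u)"
    using assms unfolding oct_R_def oct_v_def power2_eq_square
    by (simp add: divide_simps) (simp add: eval_nat_numeral)
  finally show ?thesis .
qed

text \<open>At \<open>i = - m - n\<close> and \<open>j = - m\<close> these are the parameters
  \<open>s\<close> and \<open>c\<close> belonging to \<open>oct_r n m\<close>.\<close>

abbreviation par_s :: "int \<Rightarrow> real" where "par_s i \<equiv> of_int i - 1 / 12"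
abbreviation par_c :: "int \<Rightarrow> real" where "par_c j \<equiv> of_int j + 3 / 4"

text \<open>\<open>D\<close> can be solved for \<open>T\<close>, so rationality of
  \<open>Z i j\<close> alone passes to its derivative and then to \<open>T i j\<close>. Now
  \<open>A\<close>, \<open>B\<close> and \<open>V\<close> give the steps to
  \<open>(i + 1, j)\<close>, \<open>(i, j - 1)\<close> and \<open>(i + 2, j + 1)\<close>. The
  opposite steps use relations from which \<open>T\<close> is eliminated; their constant
  coefficients \<open>par_s i\<close> and \<open>par_s i - 2 * par_c j\<close> never vanish.\<close>

lemma ladder_rational:
  fixes Z T :: "int \<Rightarrow> int \<Rightarrow> real \<Rightarrow> real"
  assumes S: "open S" "S \<subseteq> oct_S"
    and A: "\<And>i j u. u \<in> S \<Longrightarrow> 2 * T i j u + par_s i * Z i j u = oct_e u * Z (i + 1) j u"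
    and B: "\<And>i j u. u \<in> S \<Longrightarrow> T i j u + (par_c j - 1) * Z i j u = Z i (j - 1) u"
    and V: "\<And>i j u. u \<in> S \<Longrightarrow> T i j u = - 27 * oct_v u * Z (i + 2) (j + 1) u"
    and D: "\<And>i j u. u \<in> S \<Longrightarrow> (Z i j has_field_derivative
       ((oct_f u)\<^sup>2 / (u * (1 - u)) * T i j u - par_s i * (- 33 - 66 * u + 3 * u\<^sup>2) * Z i j u) / oct_e u) (at u)"
    and base: "rational_on S (Z 0 0)"
  shows "rational_on S (Z i j)"
proof -
  have nz: "oct_e u \<noteq> 0" "oct_v u \<noteq> 0" "oct_f u \<noteq> 0" "u \<noteq> 0" "1 - u \<noteq> 0" if "u \<in> S" for u
    using oct_SD[of u] S that by auto
  have e_poly: "oct_e = poly [:1, -33, -33, 1:]" and f_poly: "oct_f = poly [:1, 14, 1:]"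
    and v_poly: "oct_v = poly [:0, 1, -4, 6, -4, 1:]"
    and u_poly: "(\<lambda>u. u * (1 - u)) = poly [:0, 1, -1 :: real:]"
    and e'_poly: "(\<lambda>u. - 33 - 66 * u + 3 * u\<^sup>2) = poly [:-33, -66, 3 :: real:]"
    by (auto simp: fun_eq_iff oct_e_def oct_f_def oct_v_def power2_eq_square algebra_simps power_numeral_reduce)
  note rat_polys = rational_on_poly[of S "[:1, -33, -33, 1:]", folded e_poly]
    rational_on_poly[of S "[:1, 14, 1:]", folded f_poly]
    rational_on_poly[of S "[:0, 1, -4, 6, -4, 1:]", folded v_poly]
    rational_on_poly[of S "[:0, 1, -1:]", folded u_poly]
    rational_on_poly[of S "[:-33, -66, 3:]", folded e'_poly]
  note rat_intros = rat_polys rational_on_const rational_on_add rational_on_diff rational_on_mult rational_on_divide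
  have nint: "par_s i \<noteq> 0" "par_s i - 2 * par_c j \<noteq> 0" for i j :: int
  proof -
    show "par_s i \<noteq> 0"
    proof
      assume "par_s i = 0"
      hence "real_of_int (12 * i) = real_of_int 1" by simp
      hence "12 * i = 1" by (simp only: of_int_eq_iff)
      thus False by presburger
    qed
    show "par_s i - 2 * par_c j \<noteq> 0"
    proof
      assume "par_s i - 2 * par_c j = 0"
      hence "real_of_int (12 * i) = real_of_int (24 * j + 19)" by simp
      hence "12 * i = 24 * j + 19" by (simp only: of_int_eq_iff)
      thus False by presburger
    qed
  qed
  \<comment> \<open>\<open>A\<close> minus twice \<open>B\<close>, both at
    \<open>(i, j + 1)\<close>.\<close>
  have three_term: "(par_s i - 2 * par_c j) * Z i (j + 1) u = oct_e u * Z (i + 1) (j + 1) u - 2 * Z i j u"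
    if "u \<in> S" for i j u
    using A[OF that, of i "j + 1"] B[OF that, of i "j + 1"] by (simp add: algebra_simps)
  have T: "rational_on S (T i j)" if Z: "rational_on S (Z i j)" for i j
  proof -
    have "rational_on S (\<lambda>u. ((oct_f u)\<^sup>2 / (u * (1 - u)) * T i j u -
             par_s i * (- 33 - 66 * u + 3 * u\<^sup>2) * Z i j u) / oct_e u)" (is "rational_on S ?d")
      by (rule rational_on_deriv[OF Z S(1) D])
    have "rational_on S (\<lambda>u. (?d u * oct_e u + par_s i * (- 33 - 66 * u + 3 * u\<^sup>2) * Z i j u) *
              (u * (1 - u)) / (oct_f u * oct_f u))"
      by (intro rat_intros Z \<open>rational_on S ?d\<close>) (use nz in auto)
    also have "?this \<longleftrightarrow> rational_on S (T i j)"
      using nz by (intro rational_on_cong) (simp add: power2_eq_square)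
    finally show ?thesis .
  qed
  have up_s: "rational_on S (Z (i + 1) j)" if Z: "rational_on S (Z i j)" for i j
  proof -
    have "rational_on S (\<lambda>u. (2 * T i j u + par_s i * Z i j u) / oct_e u)"
      by (intro rat_intros Z T) (use nz in auto)
    also have "?this \<longleftrightarrow> ?thesis" using nz A by (intro rational_on_cong) auto
    finally show ?thesis .
  qed
  have down_c: "rational_on S (Z i (j - 1))" if Z: "rational_on S (Z i j)" for i j
  proof -
    have "rational_on S (\<lambda>u. T i j u + (par_c j - 1) * Z i j u)"
      by (intro rat_intros Z T)
    also have "?this \<longleftrightarrow> ?thesis" using B by (intro rational_on_cong) auto
    finally show ?thesis .
  qed
  have diag: "rational_on S (Z (i + 2) (j + 1))" if Z: "rational_on S (Z i j)" for i j
  proof -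
    have "rational_on S (\<lambda>u. T i j u / (- 27 * oct_v u))"
      by (intro rat_intros Z T) (use nz in auto)
    also have "?this \<longleftrightarrow> ?thesis" using nz V by (intro rational_on_cong) auto
    finally show ?thesis .
  qed
  have solve_c: "rational_on S (Z i (j + 1))" if "rational_on S (Z (i + 1) (j + 1))" "rational_on S (Z i j)" for i j
  proof -
    have "rational_on S (\<lambda>u. (oct_e u * Z (i + 1) (j + 1) u - 2 * Z i j u) / (par_s i - 2 * par_c j))"
      by (intro rat_intros that) (use nint in auto)
    also have "?this \<longleftrightarrow> ?thesis"
      by (intro rational_on_cong) (simp only: three_term[symmetric] nonzero_mult_div_cancel_left[OF nint(2)])
    finally show ?thesis .
  qed
  have up_c: "rational_on S (Z i (j + 1))" if Z: "rational_on S (Z i j)" for i j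
  proof (rule solve_c[OF _ Z])
    \<comment> \<open>A first use of \<open>solve_c\<close>, from the values at
      \<open>(i + 2, j + 1)\<close> and \<open>(i + 1, j)\<close>.\<close>
    show "rational_on S (Z (i + 1) (j + 1))"
      using solve_c[of "i + 1" j] diag[OF Z] up_s[OF Z] by (simp only: add.assoc one_add_one)
  qed
  have down_s: "rational_on S (Z (i - 1) j)" if Z: "rational_on S (Z i j)" for i j
  proof -
    \<comment> \<open>Eliminating \<open>T\<close> from \<open>A\<close> and \<open>V\<close> at
      \<open>(i - 1, j - 1)\<close> reaches that diagonal neighbour first; \<open>solve_c\<close>
      then raises \<open>j - 1\<close> to \<open>j\<close>.\<close>
    have "rational_on S (\<lambda>u. (oct_e u * Z i (j - 1) u - 2 * (- 27 * oct_v u * Z (i + 1) j u)) / par_s (i - 1))"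
      by (intro rat_intros up_s down_c Z nint)
    also have "?this \<longleftrightarrow> rational_on S (Z (i - 1) (j - 1))"
    proof (rule rational_on_cong)
      fix u assume u: "u \<in> S"
      have e: "par_s (i - 1) * Z (i - 1) (j - 1) u = oct_e u * Z i (j - 1) u - 2 * (- 27 * oct_v u * Z (i + 1) j u)"
        using A[OF u, of "i - 1" "j - 1"] V[OF u, of "i - 1" "j - 1"] by (simp add: algebra_simps)
      show "(oct_e u * Z i (j - 1) u - 2 * (- 27 * oct_v u * Z (i + 1) j u)) / par_s (i - 1) = Z (i - 1) (j - 1) u"
        by (simp only: e[symmetric] nonzero_mult_div_cancel_left[OF nint(1)])
    qed
    finally have "rational_on S (Z (i - 1) (j - 1))" .
    from solve_c[of "i - 1" "j - 1", OF _ this] Z show ?thesis by (simp only: diff_add_cancel)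
  qed
  have "rational_on S (Z i 0)"
    by (induction i rule: int_induct[where k = 0]; use base up_s down_s in blast)
  thus ?thesis
    by (induction j rule: int_induct[where k = 0]; use up_c down_c in blast)
qed

subsection \<open>The two algebraic base cases\<close>

text \<open>\<open>4 * sqrt 3 - 7\<close> is the zero of \<open>oct_f\<close> between
  \<open>- 1\<close> and \<open>0\<close>, so this is the component of \<open>oct_S\<close> that
  ends at \<open>0\<close>.\<close>

definition oct_I :: "real set" where "oct_I = {4 * sqrt 3 - 7<..<0}"

lemma oct_f_factor: "oct_f u = (u + 7 - 4 * sqrt 3) * (u + 7 + 4 * sqrt 3)"
  by (simp add: oct_f_def algebra_simps power2_eq_square)

lemma sqrt3_bounds: "4 * sqrt 3 < (7 :: real)" "4 * sqrt 3 > (6 :: real)"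
proof -
  show "4 * sqrt 3 < (7 :: real)"
    by (rule power_less_imp_less_base[of _ 2]) (auto simp: power_mult_distrib)
  show "4 * sqrt 3 > (6 :: real)"
    by (rule power_less_imp_less_base[of _ 2]) (auto simp: power_mult_distrib)
qed

lemma oct_I_iff: "u \<in> oct_I \<longleftrightarrow> u \<in> oct_S \<and> u > -1"
  using sqrt3_bounds by (auto simp: oct_I_def oct_S_def oct_f_factor zero_less_mult_iff)

definition oct_e' :: "real \<Rightarrow> real" where "oct_e' u = - 33 - 66 * u + 3 * u\<^sup>2"

text \<open>
  The derivative of \<open>ln (oct_e u powr s * (1 - u) powr - k)\<close> with respect to \<open>oct_R u\<close>; the condition
  \<open>riccati s c k\<close> below is the hypergeometric equation for this function in Riccati form.
\<close>

definition oct_\<beta> :: "real \<Rightarrow> real \<Rightarrow> real \<Rightarrow> real" where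
  "oct_\<beta> s k u = (s * oct_e' u * (1 - u) + k * oct_e u) * (oct_e u)\<^sup>2 / (- 108 * (1 - u) ^ 4 * (oct_f u)\<^sup>2)"

definition oct_\<beta>' :: "real \<Rightarrow> real \<Rightarrow> real \<Rightarrow> real" where
  "oct_\<beta>' s k u =
     (((s * (- 66 + 6 * u) * (1 - u) - s * oct_e' u + k * oct_e' u) * oct_e u +
       (s * oct_e' u * (1 - u) + k * oct_e u) * (2 * oct_e' u)) * (1 - u) * oct_f u -
      (s * oct_e' u * (1 - u) + k * oct_e u) * oct_e u * (- 4 * oct_f u + (1 - u) * (2 * (14 + 2 * u))))
      * oct_e u / (- 108 * (1 - u) ^ 5 * oct_f u ^ 3)"

text \<open>Stated for arbitrary reals, so that the common factors cancel without expanding the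
  octahedral polynomials.\<close>

lemma oct_beta_quotient_rule:
  fixes e f w n :: real
  assumes "f \<noteq> 0" "w \<noteq> 0"
  shows "((n' * e\<^sup>2 + n * (2 * (e * e'))) * (- 108 * w ^ 4 * f\<^sup>2) -
      (n * e\<^sup>2) * (- 108 * (- (4 * w ^ 3)) * f\<^sup>2 - 108 * w ^ 4 * (2 * (f * f'))))
     / ((- 108 * w ^ 4 * f\<^sup>2) * (- 108 * w ^ 4 * f\<^sup>2)) =
    ((n' * e + n * (2 * e')) * w * f - n * e * (- 4 * f + w * (2 * f'))) * e / (- 108 * w ^ 5 * f ^ 3)"
  by (subst frac_eq_eq) (use assms in \<open>auto simp: eval_nat_numeral algebra_simps\<close>)

lemma has_field_derivative_oct_\<beta>:
  assumes "u \<noteq> 1" "oct_f u \<noteq> 0"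
  shows "(oct_\<beta> s k has_field_derivative oct_\<beta>' s k u) (at u)"
proof -
  have e': "(oct_e' has_field_derivative (- 66 + 6 * u)) (at u)"
    unfolding oct_e'_def[abs_def] by (auto intro!: derivative_eq_intros)
  have e: "(oct_e has_field_derivative oct_e' u) (at u)"
    unfolding oct_e'_def by (rule has_field_derivative_oct_e)
  have f: "(oct_f has_field_derivative (14 + 2 * u)) (at u)"
    unfolding oct_f_def[abs_def] by (auto intro!: derivative_eq_intros)
  have w: "(1 - u) \<noteq> 0" using assms by simp
  define n where "n = s * oct_e' u * (1 - u) + k * oct_e u"
  define n' where "n' = s * (- 66 + 6 * u) * (1 - u) - s * oct_e' u + k * oct_e' u"
  have "(oct_\<beta> s k has_field_derivative
     ((n' * (oct_e u)\<^sup>2 + n * (2 * (oct_e u * oct_e' u))) * (- 108 * (1 - u) ^ 4 * (oct_f u)\<^sup>2) -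
      (n * (oct_e u)\<^sup>2) * (- 108 * (- (4 * (1 - u) ^ 3)) * (oct_f u)\<^sup>2 - 108 * (1 - u) ^ 4 * (2 * (oct_f u * (14 + 2 * u)))))
     / ((- 108 * (1 - u) ^ 4 * (oct_f u)\<^sup>2) * (- 108 * (1 - u) ^ 4 * (oct_f u)\<^sup>2))) (at u)"
    unfolding oct_\<beta>_def[abs_def] n_def n'_def
    by (rule DERIV_divide; insert assms, auto intro!: derivative_eq_intros e e' f simp: algebra_simps)
  also have "((n' * (oct_e u)\<^sup>2 + n * (2 * (oct_e u * oct_e' u))) * (- 108 * (1 - u) ^ 4 * (oct_f u)\<^sup>2) -
      (n * (oct_e u)\<^sup>2) * (- 108 * (- (4 * (1 - u) ^ 3)) * (oct_f u)\<^sup>2 - 108 * (1 - u) ^ 4 * (2 * (oct_f u * (14 + 2 * u)))))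
     / ((- 108 * (1 - u) ^ 4 * (oct_f u)\<^sup>2) * (- 108 * (1 - u) ^ 4 * (oct_f u)\<^sup>2)) = oct_\<beta>' s k u"
    unfolding oct_\<beta>'_def n_def[symmetric] n'_def[symmetric] by (rule oct_beta_quotient_rule) (use assms w in auto)
  finally show ?thesis .
qed

definition riccati :: "real \<Rightarrow> real \<Rightarrow> real \<Rightarrow> bool" where
  "riccati s c k \<longleftrightarrow> (\<forall>u\<in>oct_I.
     s * (s + 1) / 4 * oct_e u / (u * (1 - u) * oct_f u) - oct_\<beta>' s k u =
     - oct_\<beta> s k u * (oct_e u * ((s + 3/2) * oct_R u - c) / (u * (1 - u) * oct_f u)
        - (s * oct_e' u / oct_e u + k / (1 - u))))"

text \<open>Multiplication by \<open>- 108 * w ^ 5 * f ^ 3 * u / e\<close>, with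
  \<open>w = 1 - u\<close> and with \<open>e\<close>, \<open>f\<close> the values of
  \<open>oct_e\<close> and \<open>oct_f\<close>, clears all denominators and leaves a polynomial
  identity in \<open>u\<close>.\<close>

lemma riccatiI:
  assumes "\<And>u. - 27 * s * (s + 1) * (1 - u) ^ 4 * (oct_f u)\<^sup>2 -
      (((s * (- 66 + 6 * u) * (1 - u) - s * oct_e' u + k * oct_e' u) * oct_e u +
       (s * oct_e' u * (1 - u) + k * oct_e u) * (2 * oct_e' u)) * (1 - u) * oct_f u -
      (s * oct_e' u * (1 - u) + k * oct_e u) * oct_e u * (- 4 * oct_f u + (1 - u) * (2 * (14 + 2 * u)))) * u =
     (s * oct_e' u * (1 - u) + k * oct_e u) * (108 * (s + 3/2) * u * (1 - u) ^ 4 + c * (oct_e u)\<^sup>2) +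
     (s * oct_e' u * (1 - u) + k * oct_e u)\<^sup>2 * oct_f u * u"
  shows "riccati s c k"
  unfolding riccati_def
proof
  fix u assume "u \<in> oct_I"
  hence nz: "u \<noteq> 0" "oct_e u \<noteq> 0" "oct_f u \<noteq> 0" "1 - u \<noteq> 0" by (auto simp: oct_I_iff dest: oct_SD)
  define w e f where wef: "w = 1 - u" "e = oct_e u" "f = oct_f u"
  define n where "n = s * oct_e' u * w + k * e"
  define B where "B = ((s * (- 66 + 6 * u) * w - s * oct_e' u + k * oct_e' u) * e + n * (2 * oct_e' u)) * w * f -
      n * e * (- 4 * f + w * (2 * (14 + 2 * u)))"
  define m where "m = - 108 * w ^ 5 * f ^ 3 * u / e"
  have nz': "u \<noteq> 0" "e \<noteq> 0" "f \<noteq> 0" "w \<noteq> 0" "m \<noteq> 0" using nz by (auto simp: wef m_def)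
  have key: "- 27 * s * (s + 1) * w ^ 4 * f\<^sup>2 - B * u =
      n * (108 * (s + 3/2) * u * w ^ 4 + c * e\<^sup>2) + n\<^sup>2 * f * u"
    using assms[of u] unfolding B_def n_def wef .
  have R: "oct_R u = - 108 * u * w ^ 4 / e\<^sup>2" by (simp add: oct_R_def oct_v_def wef)
  have b: "oct_\<beta> s k u = n * e\<^sup>2 / (- 108 * w ^ 4 * f\<^sup>2)"
    unfolding oct_\<beta>_def n_def wef ..
  have b': "oct_\<beta>' s k u = B * e / (- 108 * w ^ 5 * f ^ 3)"
    unfolding oct_\<beta>'_def B_def n_def wef ..
  have g: "s * oct_e' u / e + k / w = n / (e * w)"
    using nz' by (simp add: n_def add_divide_distrib)
  have 1: "m * (s * (s + 1) / 4 * e / (u * w * f)) = - 27 * s * (s + 1) * w ^ 4 * f\<^sup>2"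
    unfolding m_def using nz' by (simp add: divide_simps) (simp add: eval_nat_numeral)
  have 2: "m * oct_\<beta>' s k u = B * u"
    unfolding m_def b' using nz' by (simp add: divide_simps)
  have 3: "m * oct_\<beta> s k u = n * e * w * f * u"
    unfolding m_def b using nz' by (simp add: divide_simps) (simp add: eval_nat_numeral)
  have 4: "n * e * w * f * u * (e * ((s + 3/2) * oct_R u - c) / (u * w * f)) =
     - n * (108 * (s + 3/2) * u * w ^ 4 + c * e\<^sup>2)"
  proof -
    have "n * e * w * f * u * (e * ((s + 3/2) * oct_R u - c) / (u * w * f)) = n * (e\<^sup>2 * ((s + 3/2) * oct_R u - c))"
      using nz' by (simp add: power2_eq_square)
    also have "e\<^sup>2 * ((s + 3/2) * oct_R u - c) = (s + 3/2) * (e\<^sup>2 * oct_R u) - c * e\<^sup>2"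
      by (simp add: algebra_simps)
    also have "e\<^sup>2 * oct_R u = - 108 * u * w ^ 4" unfolding R using nz' by simp
    finally show ?thesis by (simp add: algebra_simps)
  qed
  have 5: "n * e * w * f * u * (n / (e * w)) = n\<^sup>2 * f * u"
    using nz' by (simp add: power2_eq_square)
  define X Y W where "X = s * (s + 1) / 4 * e / (u * w * f)"
    and "Y = e * ((s + 3/2) * oct_R u - c) / (u * w * f)" and "W = n / (e * w)"
  have "m * (X - oct_\<beta>' s k u) = m * X - m * oct_\<beta>' s k u"
    by (rule right_diff_distrib)
  also have "\<dots> = - (m * oct_\<beta> s k u * Y) + m * oct_\<beta> s k u * W"
    unfolding 3 X_def 1 2 Y_def 4 W_def 5 key by (simp only: mult_minus_left minus_minus)
  also have "\<dots> = m * (- oct_\<beta> s k u * (Y - W))"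
    by (simp only: mult_minus_left mult_minus_right right_diff_distrib mult.assoc minus_diff_eq uminus_add_conv_diff)
  finally have "X - oct_\<beta>' s k u = - oct_\<beta> s k u * (Y - W)"
    using nz'(5) by (metis mult_left_cancel)
  thus "s * (s + 1) / 4 * oct_e u / (u * (1 - u) * oct_f u) - oct_\<beta>' s k u =
     - oct_\<beta> s k u * (oct_e u * ((s + 3/2) * oct_R u - c) / (u * (1 - u) * oct_f u)
        - (s * oct_e' u / oct_e u + k / (1 - u)))"
    unfolding wef[symmetric] g X_def Y_def W_def .
qed

text \<open>The parameters of \<open>m = n = 0\<close>. The candidate is the pure power
  \<open>oct_e u powr (- 1 / 12)\<close>, which corresponds to the octahedral function being 1
  there.\<close>

lemma riccati_first_solution: "riccati (- 1 / 12) (3 / 4) 0"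
  by (rule riccatiI) (unfold oct_e_def oct_f_def oct_e'_def, simp add: power2_eq_square power3_eq_cube power4_eq_xxxx, simp add: field_simps)

text \<open>The parameters are \<open>s + 2 - 2 * c\<close> and \<open>2 - c\<close> at
  \<open>s = - 1 / 12\<close>, \<open>c = 3 / 4\<close>. The value \<open>k = 1\<close> is chosen
  because the accompanying power \<open>oct_R u powr (1 / 4)\<close> contains a factor
  \<open>1 - u\<close>, which has to disappear.\<close>

lemma riccati_second_solution: "riccati (5 / 12) (5 / 4) 1"
  by (rule riccatiI) (unfold oct_e_def oct_f_def oct_e'_def, simp add: power2_eq_square power3_eq_cube power4_eq_xxxx, simp add: field_simps)

text \<open>This is the hypergeometric equation solved for the second derivative. It results from
  computing \<open>s * (s + 1) * legendre_2F1 (s + 2) c x\<close> in two ways: by lowering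
  \<open>c + 1\<close> in the first derivative, and by two upper shifts, the first of which is also
  differentiated.\<close>

lemma has_field_derivative_legendre_2F1_2:
  assumes x: "\<bar>x\<bar> < 1" "x \<noteq> 0" and c: "c \<notin> \<int>"
  shows "((\<lambda>x. s * (s + 1) / (4 * c) * legendre_2F1 (s + 2) (c + 1) x) has_field_derivative
           (((s + 3/2) * x - c) * (s * (s + 1) / (4 * c) * legendre_2F1 (s + 2) (c + 1) x) +
             s * (s + 1) / 4 * legendre_2F1 s c x) / (x * (1 - x))) (at x)"
proof -
  define k where "k = s * (s + 1) / (4 * c)"
  define y where "y = legendre_2F1 s c x"
  define y1 where "y1 = k * legendre_2F1 (s + 2) (c + 1) x"
  define D where "D = k * ((s + 2) * (s + 2 + 1) / (4 * (c + 1)) * legendre_2F1 (s + 2 + 2) (c + 1 + 1) x)"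
  have c1: "c + 1 \<notin> \<int>" using c by (metis Ints_1 Ints_diff add_diff_cancel_right')
  have c0: "c \<noteq> 0" using c by auto
  have D: "((\<lambda>x. k * legendre_2F1 (s + 2) (c + 1) x) has_field_derivative D) (at x)"
    unfolding D_def by (intro DERIV_cmult has_field_derivative_legendre_2F1 x)
  have y: "(legendre_2F1 s c has_field_derivative y1) (at x)"
    using has_field_derivative_legendre_2F1[OF x(1), of s c] by (simp add: y1_def k_def)
  have "x * D + c * y1 = k * c * legendre_2F1 (s + 2) c x"
  proof -
    define E where "E = (s + 2) * (s + 2 + 1) / (4 * (c + 1)) * legendre_2F1 (s + 2 + 2) (c + 1 + 1) x"
    have "x * E + c * legendre_2F1 (s + 2) (c + 1) x = c * legendre_2F1 (s + 2) c x"
      using legendre_2F1_shift_lower[OF x(1) c1, of "s + 2"] by (simp add: E_def)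
    hence "k * (x * E + c * legendre_2F1 (s + 2) (c + 1) x) = k * (c * legendre_2F1 (s + 2) c x)"
      by simp
    thus ?thesis unfolding D_def E_def[symmetric] y1_def by (simp add: algebra_simps)
  qed
  moreover have "k * c = s * (s + 1) / 4" using c0 by (simp add: k_def)
  moreover have "s * (s + 1) * legendre_2F1 (s + 2) c x =
      2 * x * (2 * (y1 + x * D) + s * y1) + (s + 1) * (x * (2 * y1) + s * y)"
  proof -
    define E where "E = (s + 1) * (s + 1 + 1) / (4 * c) * legendre_2F1 (s + 1 + 2) (c + 1) x"
    have E1: "x * (2 * y1) + s * y = s * legendre_2F1 (s + 1) c x"
      using legendre_2F1_shift_upper[OF x(1), of s c] by (simp add: y1_def k_def y_def)
    have E2: "x * (2 * E) + (s + 1) * legendre_2F1 (s + 1) c x = (s + 1) * legendre_2F1 (s + 2) c x"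
      using legendre_2F1_shift_upper[OF x(1), of "s + 1" c] by (simp add: E_def add.assoc)
    have "((\<lambda>x. s * legendre_2F1 (s + 1) c x) has_field_derivative s * E) (at x)"
      unfolding E_def by (intro DERIV_cmult has_field_derivative_legendre_2F1 x)
    moreover have "((\<lambda>x. x * (2 * (k * legendre_2F1 (s + 2) (c + 1) x)) + s * legendre_2F1 s c x)
        has_field_derivative (1 * (2 * y1) + (2 * D) * x) + s * y1) (at x)"
      unfolding y1_def by (intro DERIV_add DERIV_mult DERIV_ident DERIV_cmult D y[unfolded y1_def])
    moreover have "((\<lambda>x. x * (2 * (k * legendre_2F1 (s + 2) (c + 1) x)) + s * legendre_2F1 s c x)
        has_field_derivative s * E) (at x)"
    proof (rule has_field_derivative_transform_within_open[OF calculation(1), of "{-1<..<1}"])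
      fix t :: real assume "t \<in> {-1<..<1}"
      hence "\<bar>t\<bar> < 1" by auto
      from legendre_2F1_shift_upper[OF this, of s c]
      show "s * legendre_2F1 (s + 1) c t = t * (2 * (k * legendre_2F1 (s + 2) (c + 1) t)) + s * legendre_2F1 s c t"
        by (simp add: k_def)
    qed (use x in auto)
    ultimately have "s * E = (1 * (2 * y1) + (2 * D) * x) + s * y1"
      by (blast intro: DERIV_unique)
    hence "2 * x * (2 * (y1 + x * D) + s * y1) = 2 * x * (s * E)" by (simp add: algebra_simps)
    moreover have "s * ((s + 1) * legendre_2F1 (s + 2) c x) =
        2 * x * (s * E) + (s + 1) * (s * legendre_2F1 (s + 1) c x)"
      unfolding E2[symmetric] by (simp add: algebra_simps)
    ultimately show ?thesis unfolding E1 by (simp add: algebra_simps)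
  qed
  ultimately have "4 * (x * D + c * y1) =
      2 * x * (2 * (y1 + x * D) + s * y1) + (s + 1) * (x * (2 * y1) + s * y)"
    by simp
  hence "4 * (x * (1 - x)) * D = 4 * (((s + 3/2) * x - c) * y1 + s * (s + 1) / 4 * y)"
    by (simp add: algebra_simps)
  hence "(x * (1 - x)) * D = ((s + 3/2) * x - c) * y1 + s * (s + 1) / 4 * y"
    by simp
  moreover have "x * (1 - x) \<noteq> 0" using x by auto
  ultimately have "D = (((s + 3/2) * x - c) * y1 + s * (s + 1) / 4 * y) / (x * (1 - x))"
    by (metis nonzero_mult_div_cancel_left)
  with D show ?thesis unfolding y1_def y_def k_def by simp
qed

text \<open>
  The Wronskian of the two sides, times the usual integrating factor, is constant; it vanishes since
  the integrating factor contains \<open>oct_R t powr c\<close>, which tends to \<open>0\<close>.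
\<close>

lemma pullback_legendre_2F1:
  assumes ric: "riccati s c k" and c: "c > 0" "c \<notin> \<int>" and sc: "s + 3/2 - c = 2/3"
    and t: "t \<in> oct_I"
  shows "legendre_2F1 s c (oct_R t) = oct_e t powr s * (1 - t) powr (- k)"
proof -
  define y1 where "y1 = (\<lambda>x. s * (s + 1) / (4 * c) * legendre_2F1 (s + 2) (c + 1) x)"
  define \<gamma> where "\<gamma> = (\<lambda>u. s * oct_e' u / oct_e u + k / (1 - u))"
  define R' where "R' = (\<lambda>u. oct_R u * (oct_f u)\<^sup>2 / (u * (1 - u) * oct_e u))"
  \<comment> \<open>\<open>oct_\<beta>\<close> is the logarithmic derivative of \<open>g\<close>
    with respect to \<open>x = oct_R u\<close>, so \<open>g * E\<close> is a Wronskian in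
    \<open>x\<close>. Below, \<open>exp (L u)\<close> is \<open>g\<close> times the integrating
    factor with exponents \<open>c\<close> at \<open>x\<close> and \<open>s + 3/2 - c\<close> at
    \<open>1 - x\<close>; the latter is 2/3 in both base cases.\<close>
  define E where "E = (\<lambda>u. y1 (oct_R u) - legendre_2F1 s c (oct_R u) * oct_\<beta> s k u)"
  define L where "L = (\<lambda>u. c * ln (oct_R u) + 2/3 * ln (1 - oct_R u) + s * ln (oct_e u) - k * ln (1 - u))"
  define g where "g = (\<lambda>u. oct_e u powr s * (1 - u) powr (- k))"
  have I: "u < 0" "oct_e u > 0" "oct_f u > 0" "1 - u > 0" "oct_R u > 0" "oct_R u < 1" "u \<in> oct_S" if "u \<in> oct_I" for u
    using that oct_SD[of u] oct_R_bounds[of u] by (auto simp: oct_I_iff)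
  have dR: "(oct_R has_field_derivative R' u) (at u)" if "u \<in> oct_I" for u
    unfolding R'_def using I[OF that] by (intro has_field_derivative_oct_R) auto
  have de: "(oct_e has_field_derivative oct_e' u) (at u)" for u
    unfolding oct_e'_def by (rule has_field_derivative_oct_e)
  have dy: "((\<lambda>u. legendre_2F1 s c (oct_R u)) has_field_derivative y1 (oct_R u) * R' u) (at u)" if "u \<in> oct_I" for u
    unfolding y1_def using I[OF that] by (intro DERIV_chain2[OF has_field_derivative_legendre_2F1] dR that) auto
  have R'\<beta>: "R' u * oct_\<beta> s k u = \<gamma> u" if "u \<in> oct_I" for u
  proof -
    define w e f where wef: "w = 1 - u" "e = oct_e u" "f = oct_f u"
    define n where "n = s * oct_e' u * w + k * e"
    have nz: "u \<noteq> 0" "e \<noteq> 0" "f \<noteq> 0" "w \<noteq> 0" using I[OF that] by (auto simp: wef)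
    have "R' u * oct_\<beta> s k u = (- 108 * (u * w ^ 4) / e\<^sup>2 * f\<^sup>2 / (u * w * e)) * (n * e\<^sup>2 / (- 108 * w ^ 4 * f\<^sup>2))"
      unfolding R'_def oct_\<beta>_def oct_R_def oct_v_def n_def wef ..
    also have "\<dots> = n / (e * w)"
      using nz by (simp add: divide_simps)
    also have "\<dots> = \<gamma> u"
      unfolding \<gamma>_def wef[symmetric] n_def using nz by (simp add: add_divide_distrib)
    finally show ?thesis .
  qed
  have R'x: "R' u / (oct_R u * (1 - oct_R u)) = oct_e u / (u * (1 - u) * oct_f u)" if "u \<in> oct_I" for u
  proof -
    have "1 - oct_R u = oct_f u ^ 3 / (oct_e u)\<^sup>2"
      using I[OF that] oct_identity[of u] by (simp add: oct_R_def divide_simps)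
    thus ?thesis using I[OF that] unfolding R'_def
      by (simp add: divide_simps) (simp add: eval_nat_numeral mult_ac)
  qed
  have dE: "(E has_field_derivative
      (oct_e u * ((s + 3/2) * oct_R u - c) / (u * (1 - u) * oct_f u) - \<gamma> u) * E u) (at u)" if u: "u \<in> oct_I" for u
  proof -
    define x where "x = oct_R u"
    define q where "q = oct_e u / (u * (1 - u) * oct_f u)"
    define y where "y = legendre_2F1 s c x"
    have x: "x \<noteq> 0" "\<bar>x\<bar> < 1" using I[OF u] by (auto simp: x_def)
    have q: "R' u = q * (x * (1 - x))"
      using R'x[OF u] x by (auto simp: q_def x_def divide_simps)
    have "((\<lambda>u. y1 (oct_R u)) has_field_derivative
       ((((s + 3/2) * x - c) * y1 x + s * (s + 1) / 4 * y) / (x * (1 - x))) * R' u) (at u)"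
      using DERIV_chain2[OF has_field_derivative_legendre_2F1_2[OF x(2,1) c(2), of s, unfolded x_def] dR[OF u]]
      unfolding y1_def y_def x_def by simp
    moreover have "((((s + 3/2) * x - c) * y1 x + s * (s + 1) / 4 * y) / (x * (1 - x))) * R' u =
        q * (((s + 3/2) * x - c) * y1 x + s * (s + 1) / 4 * y)"
      unfolding q using x by simp
    ultimately have d1: "((\<lambda>u. y1 (oct_R u)) has_field_derivative
       q * (((s + 3/2) * x - c) * y1 x + s * (s + 1) / 4 * y)) (at u)"
      by simp
    have d2: "((\<lambda>u. legendre_2F1 s c (oct_R u) * oct_\<beta> s k u) has_field_derivative
        y1 x * R' u * oct_\<beta> s k u + oct_\<beta>' s k u * y) (at u)"
      unfolding x_def y_def
      by (intro DERIV_mult dy u has_field_derivative_oct_\<beta>) (use I[OF u] in auto)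
    \<comment> \<open>The Riccati condition makes the coefficient of \<open>y\<close> equal to
      \<open>- oct_\<beta>\<close> times that of \<open>y1\<close>, so that \<open>E\<close>
      satisfies a first-order linear equation.\<close>
    have r: "s * (s + 1) / 4 * q - oct_\<beta>' s k u = - oct_\<beta> s k u * (q * ((s + 3/2) * x - c) - \<gamma> u)"
      using ric u unfolding riccati_def q_def x_def \<gamma>_def by simp
    have "q * (((s + 3/2) * x - c) * y1 x + s * (s + 1) / 4 * y) - (y1 x * R' u * oct_\<beta> s k u + oct_\<beta>' s k u * y) =
      (q * ((s + 3/2) * x - c) - \<gamma> u) * y1 x + (s * (s + 1) / 4 * q - oct_\<beta>' s k u) * y"
      unfolding R'\<beta>[OF u, symmetric] by (simp add: algebra_simps)
    also have "\<dots> = (q * ((s + 3/2) * x - c) - \<gamma> u) * (y1 x - y * oct_\<beta> s k u)"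
    proof -
      have "Q * y1 x + - oct_\<beta> s k u * Q * y = Q * (y1 x - y * oct_\<beta> s k u)" for Q
        by (simp add: algebra_simps)
      thus ?thesis unfolding r .
    qed
    finally show ?thesis
      using DERIV_diff[OF d1 d2] unfolding E_def x_def y_def q_def by simp
  qed
  have dL: "(L has_field_derivative - (oct_e u * ((s + 3/2) * oct_R u - c) / (u * (1 - u) * oct_f u) - \<gamma> u)) (at u)"
    if u: "u \<in> oct_I" for u
  proof -
    have "(L has_field_derivative c * (1 / oct_R u * R' u) + 2/3 * (1 / (1 - oct_R u) * (0 - R' u)) +
        s * (1 / oct_e u * oct_e' u) - k * (1 / (1 - u) * (0 - 1))) (at u)"
      unfolding L_def
      by (intro DERIV_add DERIV_diff DERIV_cmult DERIV_chain2[OF DERIV_ln_divide] dR de u DERIV_const DERIV_ident)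
         (use I[OF u] in auto)
    moreover have "c * (1 / oct_R u * R' u) + 2/3 * (1 / (1 - oct_R u) * (0 - R' u)) =
        - (R' u / (oct_R u * (1 - oct_R u)) * ((s + 3/2) * oct_R u - c))"
    proof -
      have s: "s + 3/2 = 2/3 + c" using sc by simp
      show ?thesis unfolding s using I[OF u] by (simp add: field_simps)
    qed
    ultimately show ?thesis unfolding R'x[OF u] \<gamma>_def by (elim DERIV_cong) simp
  qed
  have cv: "convex oct_I" by (simp add: oct_I_def)
  have ev: "\<forall>\<^sub>F u in at_left 0. u \<in> oct_I"
    using sqrt3_bounds eventually_at_left_real[of "4 * sqrt 3 - 7" 0] by (simp add: oct_I_def)
  \<comment> \<open>\<open>0\<close> is an end of \<open>oct_I\<close> and not a member.
    \<open>oct_\<beta>\<close> is continuous there because the covering is unramified at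
    \<open>0\<close>.\<close>
  have ptE: "isCont E 0"
  proof -
    have r: "isCont oct_R 0" "oct_R 0 = 0" "isCont (oct_\<beta> s k) 0"
      unfolding oct_R_def[abs_def] oct_\<beta>_def[abs_def] oct_e_def oct_e'_def oct_v_def oct_f_def
      by (auto intro!: continuous_intros)
    have "isCont (legendre_2F1 s' c') (oct_R 0)" for s' c'
      unfolding r by (intro DERIV_isCont[OF has_field_derivative_legendre_2F1]) simp
    from isCont_o2[OF r(1) this] have "isCont (\<lambda>u. legendre_2F1 s' c' (oct_R u)) 0" for s' c' .
    with r(3) show ?thesis unfolding E_def y1_def by (intro continuous_intros)
  qed
  have expL: "((\<lambda>u. exp (L u)) \<longlongrightarrow> 0) (at_left 0)"
  proof -
    have "isCont oct_R 0" "oct_R 0 = 0" "isCont oct_e 0" "oct_e 0 = 1"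
      unfolding oct_R_def[abs_def] oct_e_def oct_v_def by (auto intro!: continuous_intros)
    hence r: "(oct_R \<longlongrightarrow> 0) (at_left 0)" "(oct_e \<longlongrightarrow> 1) (at_left 0)"
      by (auto simp: isCont_def filterlim_at_split)
    have "\<forall>\<^sub>F u in at_left 0. 0 \<le> oct_R u"
      using ev by eventually_elim (rule less_imp_le[OF I(5)])
    from tendsto_zero_powrI[OF r(1) tendsto_const this c(1)]
    have "((\<lambda>u. oct_R u powr c * (1 - oct_R u) powr (2/3) * (oct_e u powr s * (1 - u) powr - k)) \<longlongrightarrow>
            0 * (1 - 0) powr (2/3) * (1 powr s * (1 - 0) powr - k)) (at_left 0)"
      by (intro tendsto_mult tendsto_powr tendsto_diff r tendsto_const tendsto_ident_at) auto
    hence "((\<lambda>u. oct_R u powr c * (1 - oct_R u) powr (2/3) * g u) \<longlongrightarrow> 0) (at_left 0)"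
      by (simp add: g_def)
    moreover have "\<forall>\<^sub>F u in at_left 0. exp (L u) = oct_R u powr c * (1 - oct_R u) powr (2/3) * g u"
      using ev
    proof eventually_elim
      case (elim u)
      have e: "exp (b * ln x) = x powr b" if "x > 0" for b x :: real
        using that by (simp add: powr_def)
      have "L u = (c * ln (oct_R u) + 2/3 * ln (1 - oct_R u)) + (s * ln (oct_e u) + (- k) * ln (1 - u))"
        by (simp add: L_def)
      hence "exp (L u) = exp (c * ln (oct_R u)) * exp (2/3 * ln (1 - oct_R u)) *
              (exp (s * ln (oct_e u)) * exp (- k * ln (1 - u)))"
        by (simp only: exp_add)
      also have "\<dots> = oct_R u powr c * (1 - oct_R u) powr (2/3) * g u"
        unfolding g_def using I[OF elim] by (simp only: e diff_gt_0_iff_gt)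
      finally show ?case .
    qed
    ultimately show ?thesis by (simp add: tendsto_cong)
  qed
  have E0: "E u = 0" if u: "u \<in> oct_I" for u
  proof -
    have "((\<lambda>u. exp (L u) * E u) has_field_derivative 0) (at u within oct_I)" if "u \<in> oct_I" for u
      by (rule has_field_derivative_at_within,
          rule DERIV_cong[OF DERIV_mult[OF DERIV_chain2[OF DERIV_exp dL[OF that]] dE[OF that]]])
         (simp add: algebra_simps)
    from has_field_derivative_zero_constant[OF cv this] obtain a where
      a: "\<And>u. u \<in> oct_I \<Longrightarrow> exp (L u) * E u = a" by blast
    have "((\<lambda>u. exp (L u) * E u) \<longlongrightarrow> 0 * E 0) (at_left 0)"
      using ptE by (intro tendsto_mult expL) (simp add: isCont_def filterlim_at_split)
    moreover have "((\<lambda>u. exp (L u) * E u) \<longlongrightarrow> a) (at_left 0)"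
      by (rule tendsto_eventually) (use ev in eventually_elim, use a in auto)
    ultimately have "a = 0" by (metis tendsto_unique trivial_limit_at_left_real mult_zero_left)
    with a[OF u] show ?thesis by simp
  qed
  define h where "h = (\<lambda>u. legendre_2F1 s c (oct_R u) / g u)"
  have "(h has_field_derivative 0) (at u within oct_I)" if u: "u \<in> oct_I" for u
  proof -
    have g: "g u > 0" using I[OF u] by (simp add: g_def)
    have dg: "(g has_field_derivative
        s * oct_e u powr (s - 1) * oct_e' u * (1 - u) powr - k +
        (- k) * (1 - u) powr (- k - 1) * (0 - 1) * oct_e u powr s) (at u)"
      unfolding g_def
      by (intro DERIV_mult DERIV_chain2[OF has_real_derivative_powr] de DERIV_diff DERIV_const DERIV_ident)
         (use I[OF u] in auto)
    have "(g has_field_derivative g u * \<gamma> u) (at u)"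
      by (rule DERIV_cong[OF dg]) (use I[OF u] in \<open>simp add: g_def \<gamma>_def powr_diff algebra_simps\<close>)
    from DERIV_divide[OF dy[OF u] this] g
    have "(h has_field_derivative (y1 (oct_R u) * R' u * g u - legendre_2F1 s c (oct_R u) * (g u * \<gamma> u)) / (g u * g u)) (at u)"
      by (simp add: h_def)
    also have "y1 (oct_R u) * R' u * g u - legendre_2F1 s c (oct_R u) * (g u * \<gamma> u) = g u * R' u * E u"
      unfolding E_def R'\<beta>[OF u, symmetric] by (simp add: algebra_simps)
    finally show ?thesis using E0[OF u] by (simp add: has_field_derivative_at_within)
  qed
  from has_field_derivative_zero_constant[OF cv this] obtain a where
    a: "\<And>u. u \<in> oct_I \<Longrightarrow> h u = a" by blast
  have "isCont h 0"
  proof -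
    have r: "isCont oct_R 0" "oct_R 0 = 0" "isCont oct_e 0" "oct_e 0 = 1"
      unfolding oct_R_def[abs_def] oct_e_def oct_v_def by (auto intro!: continuous_intros)
    have "isCont (legendre_2F1 s c) (oct_R 0)"
      unfolding r by (intro DERIV_isCont[OF has_field_derivative_legendre_2F1]) simp
    from isCont_o2[OF r(1) this] have "isCont (\<lambda>u. legendre_2F1 s c (oct_R u)) 0" .
    moreover have "isCont g 0"
      unfolding g_def using r by (intro continuous_intros) auto
    ultimately show ?thesis
      unfolding h_def by (rule continuous_divide) (simp add: g_def r)
  qed
  hence "(h \<longlongrightarrow> h 0) (at_left 0)" by (simp add: isCont_def filterlim_at_split)
  moreover have "(h \<longlongrightarrow> a) (at_left 0)"
    by (rule tendsto_eventually) (use ev in eventually_elim, use a in auto)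
  moreover have "h 0 = 1" by (simp add: h_def g_def oct_R_def oct_v_def oct_e_def)
  ultimately have "a = 1" by (metis tendsto_unique trivial_limit_at_left_real)
  with a[OF t] I[OF t] show ?thesis by (simp add: h_def g_def divide_simps split: if_splits)
qed

subsection \<open>Both solutions as branches of one rational function\<close>

definition oct_branch :: "real \<Rightarrow> real \<Rightarrow> (real \<Rightarrow> real \<Rightarrow> real \<Rightarrow> real) \<Rightarrow> int \<Rightarrow> int \<Rightarrow> real \<Rightarrow> real" where
  "oct_branch \<kappa> \<epsilon> \<Phi> i j u =
     \<kappa> * \<epsilon> powi i * \<Phi> (par_s i) (par_c j) (oct_R u) * (\<epsilon> * oct_e u) powr (- par_s i)"

lemma par_notin_Ints:
  "par_s i \<notin> \<int>" "par_c j \<notin> \<int>" "par_s i - 2 * par_c j \<notin> \<int>"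
proof -
  show "par_s i \<notin> \<int>"
  proof
    assume "par_s i \<in> \<int>"
    then obtain k :: int where "par_s i = of_int k" by (auto elim: Ints_cases)
    hence "real_of_int (12 * i - 1) = of_int (12 * k)" by simp
    hence "12 * i - 1 = 12 * k" by (simp only: of_int_eq_iff)
    thus False by presburger
  qed
  show "par_c j \<notin> \<int>"
  proof
    assume "par_c j \<in> \<int>"
    then obtain k :: int where "par_c j = of_int k" by (auto elim: Ints_cases)
    hence "real_of_int (4 * j + 3) = of_int (4 * k)" by simp
    hence "4 * j + 3 = 4 * k" by (simp only: of_int_eq_iff)
    thus False by presburger
  qed
  show "par_s i - 2 * par_c j \<notin> \<int>"
  proof
    assume "par_s i - 2 * par_c j \<in> \<int>"
    then obtain k :: int where "par_s i - 2 * par_c j = of_int k" by (auto elim: Ints_cases)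
    hence "real_of_int (12 * i - 24 * j - 19) = of_int (12 * k)" by simp
    hence "12 * i - 24 * j - 19 = 12 * k" by (simp only: of_int_eq_iff)
    thus False by presburger
  qed
qed

text \<open>Here \<open>p = \<epsilon> * oct_e u\<close> is positive. A unit step in
  \<open>s\<close> divides the weight by \<open>p\<close>, and the extra factor
  \<open>\<epsilon>\<close> turns this into a division by \<open>oct_e u\<close> itself. A step by
  two divides by the square of \<open>oct_e u\<close>, which is the denominator of
  \<open>oct_R u\<close>; therefore \<open>x / 4\<close> becomes the polynomial
  \<open>- 27 * oct_v u\<close>.\<close>

lemma oct_branch_ladder:
  fixes u \<kappa> \<epsilon> :: real and i j :: int
  assumes \<Phi>: "ladder_family \<Phi>" and u: "u \<in> oct_S" and \<epsilon>: "\<epsilon> = 1 \<or> \<epsilon> = -1" "\<epsilon> * oct_e u > 0"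
  defines "Z \<equiv> oct_branch \<kappa> \<epsilon> \<Phi>"
  defines "T \<equiv> (\<lambda>i j u. - 27 * oct_v u * Z (i + 2) (j + 1) u)"
  shows "2 * T i j u + par_s i * Z i j u = oct_e u * Z (i + 1) j u"
    and "T i j u + (par_c j - 1) * Z i j u = Z i (j - 1) u"
    and "(Z i j has_field_derivative
       ((oct_f u)\<^sup>2 / (u * (1 - u)) * T i j u - par_s i * (- 33 - 66 * u + 3 * u\<^sup>2) * Z i j u) / oct_e u) (at u)"
proof -
  define s c x p where scxp: "s = par_s i" "c = par_c j" "x = oct_R u" "p = \<epsilon> * oct_e u"
  define K where "K = \<kappa> * \<epsilon> powi i * p powr (- s)"
  have par: "par_s (i + 1) = s + 1" "par_s (i + 2) = s + 2" "par_c (j + 1) = c + 1" "par_c (j - 1) = c - 1"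
    by (simp_all add: scxp)
  have x: "0 < x" "x < 1" using oct_R_bounds[OF u] by (simp_all add: scxp)
  have p: "p > 0" using \<epsilon> by (simp add: scxp)
  have \<epsilon>0: "\<epsilon> \<noteq> 0" "\<epsilon> * \<epsilon> = 1" "\<epsilon>\<^sup>2 = 1" using \<epsilon> by auto
  have e: "oct_e u = \<epsilon> * p" "oct_e u \<noteq> 0" using \<epsilon>0 \<epsilon> by (auto simp: scxp mult.assoc[symmetric])
  have L: "(\<Phi> s c has_field_derivative \<Phi> (s + 2) (c + 1) x / 4) (at x)"
    "x * \<Phi> (s + 2) (c + 1) x / 2 + s * \<Phi> s c x = \<Phi> (s + 1) c x"
    "x * \<Phi> (s + 2) (c + 1) x / 4 + (c - 1) * \<Phi> s c x = \<Phi> s (c - 1) x"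
    using \<Phi> x par_notin_Ints[of i] par_notin_Ints[of j] par_notin_Ints(3)[of i j]
    unfolding ladder_family_def scxp(1,2) by blast+
  have Z: "Z i j u = K * \<Phi> s c x" "Z i (j - 1) u = K * \<Phi> s (c - 1) x"
    by (simp_all only: Z_def oct_branch_def K_def par scxp[symmetric] mult_ac)
  have Z1: "oct_e u * Z (i + 1) j u = K * \<Phi> (s + 1) c x"
  proof -
    have "p powr (- (s + 1)) = p powr (- s) / p" using p by (simp add: powr_diff)
    moreover have "\<epsilon> powi (i + 1) = \<epsilon> powi i * \<epsilon>" using \<epsilon>0 by (simp add: power_int_add)
    ultimately have "Z (i + 1) j u = \<epsilon> * K / p * \<Phi> (s + 1) c x"
      unfolding Z_def oct_branch_def K_def par scxp[symmetric] by simp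
    hence "oct_e u * Z (i + 1) j u = (\<epsilon> * \<epsilon>) * K * \<Phi> (s + 1) c x"
      unfolding e(1) using p by simp
    thus ?thesis using \<epsilon>0 by simp
  qed
  have T: "T i j u = K * (x * \<Phi> (s + 2) (c + 1) x / 4)"
  proof -
    have "p powr (- (s + 2)) = p powr (- s) / p\<^sup>2" using p by (simp add: powr_diff powr_numeral)
    moreover have "\<epsilon> powi (i + 2) = \<epsilon> powi i * \<epsilon>\<^sup>2" using \<epsilon>0 by (simp add: power_int_add)
    ultimately have "Z (i + 2) (j + 1) u = K / p\<^sup>2 * \<Phi> (s + 2) (c + 1) x"
      using \<epsilon>0 unfolding Z_def oct_branch_def K_def par scxp[symmetric] by simp
    moreover have "x = - 108 * oct_v u / p\<^sup>2"
      using \<epsilon>0 by (simp add: scxp oct_R_def power_mult_distrib)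
    ultimately show ?thesis by (simp add: T_def)
  qed
  show "2 * T i j u + par_s i * Z i j u = oct_e u * Z (i + 1) j u"
    unfolding Z1 T Z L(2)[symmetric] scxp(1)[symmetric] by (simp add: algebra_simps)
  show "T i j u + (par_c j - 1) * Z i j u = Z i (j - 1) u"
    unfolding T Z L(3)[symmetric] scxp(2)[symmetric] by (simp add: algebra_simps)
  have u01: "u \<noteq> 0" "u \<noteq> 1" using oct_SD[OF u] by auto
  have d1: "((\<lambda>u. \<Phi> s c (oct_R u)) has_field_derivative
      \<Phi> (s + 2) (c + 1) x / 4 * (x * (oct_f u)\<^sup>2 / (u * (1 - u) * oct_e u))) (at u)"
    unfolding scxp(3) by (rule DERIV_chain2[OF L(1)[unfolded scxp(3)] has_field_derivative_oct_R[OF e(2) u01]])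
  have "((\<lambda>u. (\<epsilon> * oct_e u) powr (- s)) has_field_derivative
      (- s) * p powr (- s - 1) * (\<epsilon> * (- 33 - 66 * u + 3 * u\<^sup>2))) (at u)"
    unfolding scxp(4)
    by (rule DERIV_chain2[OF has_real_derivative_powr DERIV_cmult[OF has_field_derivative_oct_e]]) (use \<epsilon> in simp)
  from DERIV_cmult[OF DERIV_mult[OF d1 this], of "\<kappa> * \<epsilon> powi i"]
  have "(Z i j has_field_derivative
      \<kappa> * \<epsilon> powi i * (\<Phi> (s + 2) (c + 1) x / 4 * (x * (oct_f u)\<^sup>2 / (u * (1 - u) * oct_e u)) * p powr (- s) +
         (- s) * p powr (- s - 1) * (\<epsilon> * (- 33 - 66 * u + 3 * u\<^sup>2)) * \<Phi> s c x)) (at u)"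
    unfolding Z_def oct_branch_def[abs_def] scxp(1,2)[symmetric] by (simp add: mult_ac scxp)
  also have "\<kappa> * \<epsilon> powi i * (\<Phi> (s + 2) (c + 1) x / 4 * (x * (oct_f u)\<^sup>2 / (u * (1 - u) * oct_e u)) * p powr (- s) +
         (- s) * p powr (- s - 1) * (\<epsilon> * (- 33 - 66 * u + 3 * u\<^sup>2)) * \<Phi> s c x) =
       ((oct_f u)\<^sup>2 / (u * (1 - u)) * T i j u - par_s i * (- 33 - 66 * u + 3 * u\<^sup>2) * Z i j u) / oct_e u"
  proof -
    have r: "\<epsilon> / p = 1 / oct_e u" using e \<epsilon>0 p by (simp add: field_simps)
    have q: "p powr (- s - 1) = p powr (- s) / p" using p by (simp add: powr_diff)
    define d where "d = - 33 - 66 * u + 3 * u\<^sup>2"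
    have "(- s) * p powr (- s - 1) * (\<epsilon> * d) = - (s * p powr (- s) * d * (\<epsilon> / p))"
      unfolding q by simp
    also have "\<dots> = - (s * p powr (- s) * d / oct_e u)" unfolding r by simp
    finally show ?thesis
      unfolding d_def[symmetric] T Z K_def scxp(1)[symmetric]
      by (simp add: diff_divide_distrib right_diff_distrib mult_ac)
  qed
  finally show "(Z i j has_field_derivative
       ((oct_f u)\<^sup>2 / (u * (1 - u)) * T i j u - par_s i * (- 33 - 66 * u + 3 * u\<^sup>2) * Z i j u) / oct_e u) (at u)" .
qed

text \<open>
  The weight that makes both branches equal to the same constant at \<open>i = j = 0\<close>. The sign \<open>\<epsilon> powi i\<close> of
  \<open>oct_branch\<close> absorbs that \<open>oct_e\<close> is negative on the second component.
\<close>

definition branch_ratio :: real where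
  "branch_ratio = Gamma (- 1 / 12) * Gamma (5 / 4) / (Gamma (3 / 4) * Gamma (5 / 12) * 27 powr (1 / 4))"

definition oct_Z :: "int \<Rightarrow> int \<Rightarrow> real \<Rightarrow> real" where
  "oct_Z i j u = (if u > -1 then oct_branch 1 1 \<Phi>\<^sub>1 i j u else oct_branch branch_ratio (-1) \<Phi>\<^sub>2 i j u)"

text \<open>The polynomials are reciprocal up to sign and powers of \<open>u\<close>. The inversion
  carries the outer component to \<open>oct_I\<close>, where \<open>pullback_legendre_2F1\<close>
  applies.\<close>

lemma oct_invert:
  assumes "u \<in> oct_S" "u < -1"
  shows "1 / u \<in> oct_I" "oct_R (1 / u) = oct_R u" "oct_e (1 / u) = oct_e u / u ^ 3"
proof -
  have u: "u \<noteq> 0" "u < 0" using assms by auto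
  have f: "oct_f (1 / u) = oct_f u / u\<^sup>2" using u by (simp add: oct_f_def field_simps power2_eq_square)
  show e: "oct_e (1 / u) = oct_e u / u ^ 3"
    using u by (simp add: oct_e_def field_simps power2_eq_square power3_eq_cube)
  have v: "oct_v (1 / u) = oct_v u / u ^ 6"
  proof -
    have "1 - 1 / u = - ((1 - u) / u)" using u by (simp add: field_simps)
    thus ?thesis using u by (simp add: oct_v_def power_divide eval_nat_numeral)
  qed
  show "oct_R (1 / u) = oct_R u"
    unfolding oct_R_def e v using u by (simp add: power_divide flip: power_mult)
  show "1 / u \<in> oct_I"
    using assms oct_SD[OF assms(1)] u by (auto simp: oct_I_iff oct_S_def f divide_simps)
qed

lemma oct_Z_0_0:
  assumes u: "u \<in> oct_S"
  shows "oct_Z 0 0 u = Gamma (- 1 / 12) / Gamma (3 / 4)"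
proof (cases "u > -1")
  case True
  hence uI: "u \<in> oct_I" using u by (simp add: oct_I_iff)
  have e: "oct_e u > 0" using oct_SD[OF u] True by simp
  have "legendre_2F1 (- 1 / 12) (3 / 4) (oct_R u) = oct_e u powr (- 1 / 12) * (1 - u) powr (- 0)"
    using par_notin_Ints(2)[of 0] by (intro pullback_legendre_2F1[OF riccati_first_solution _ _ _ uI]) auto
  moreover have "oct_e u powr (- 1 / 12) * oct_e u powr (1 / 12) = 1"
    using e by (simp flip: powr_add)
  ultimately show ?thesis
    using True e oct_SD[OF u] by (simp add: oct_Z_def oct_branch_def \<Phi>\<^sub>1_def)
next
  case False
  hence u1: "u < -1" using oct_SD[OF u] by simp
  define a p where ap: "a = - u" "p = - oct_e u"
  have ap0: "a > 0" "p > 0" using oct_SD[OF u] u1 by (auto simp: ap)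
  note inv = oct_invert[OF u u1]
  have "5 / 4 \<notin> (\<int> :: real set)" using par_notin_Ints(2)[of "- 2"] Ints_minus[of "5/4 :: real"] by auto
  hence "legendre_2F1 (5 / 12) (5 / 4) (oct_R (1 / u)) = oct_e (1 / u) powr (5 / 12) * (1 - 1 / u) powr (- 1)"
    by (intro pullback_legendre_2F1[OF riccati_second_solution _ _ _ inv(1)]) auto
  moreover have "oct_e (1 / u) = p / a ^ 3" unfolding inv(3) by (simp add: ap)
  moreover have "(1 - 1 / u) powr (- 1) = a / (1 + a)"
    using ap0 by (simp add: powr_minus ap field_simps)
  moreover have pa: "(p / a ^ 3) powr (5 / 12) = p powr (5 / 12) / a powr (5 / 4)"
    using ap0 by (simp add: powr_divide powr_powr flip: powr_numeral)
  ultimately have F: "legendre_2F1 (5 / 12) (5 / 4) (oct_R u) = p powr (5 / 12) / a powr (5 / 4) * (a / (1 + a))"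
    unfolding inv(2) by (simp only: pa)
  have R: "oct_R u powr (1 / 4) = 4 powr (1 / 4) * 27 powr (1 / 4) * a powr (1 / 4) * (1 + a) / p powr (1 / 2)"
  proof -
    have "oct_R u = 4 * 27 * a * (1 + a) ^ 4 / p ^ 2"
      by (simp add: oct_R_def oct_v_def ap)
    moreover have "((1 + a) ^ 4) powr (1 / 4) = 1 + a"
      using ap0 by (simp add: powr_powr flip: powr_numeral)
    moreover have "(p ^ 2) powr (1 / 4) = p powr (1 / 2)"
      using ap0 by (simp add: powr_powr flip: powr_numeral)
    ultimately show ?thesis
      using ap0 by (simp only: powr_divide powr_mult)
  qed
  have "p powr (1 / 2) = p powr (5 / 12) * p powr (1 / 12)" by (simp flip: powr_add)
  moreover have "a powr (5 / 4) = a powr (1 / 4) * a" using ap0 powr_add[of a "1/4" 1] by simp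
  moreover define b where "b = 1 + a"
  moreover have "b \<noteq> 0" using ap0 by (simp add: b_def)
  \<comment> \<open>All powers of \<open>a\<close>, \<open>1 + a\<close> and \<open>p\<close>
    cancel, and the fourth root of 108 remains. Its factor \<open>4 powr (1 / 4)\<close> is
    compensated by \<open>4 powr (c - 1)\<close> in \<open>\<Phi>\<^sub>2\<close>, and
    \<open>27 powr (1 / 4)\<close> by \<open>branch_ratio\<close>.\<close>
  ultimately have "oct_R u powr (1 / 4) * legendre_2F1 (5 / 12) (5 / 4) (oct_R u) * p powr (1 / 12) =
      4 powr (1 / 4) * 27 powr (1 / 4)"
    unfolding F R b_def[symmetric] using ap0 by simp
  hence "oct_R u powr (1 / 4) * (legendre_2F1 (5 / 12) (5 / 4) (oct_R u) * p powr (1 / 12)) =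
      4 powr (1 / 4) * 27 powr (1 / 4)" by (simp only: mult.assoc)
  moreover have "Gamma (5 / 4) \<noteq> (0::real)" "Gamma (5 / 12) \<noteq> (0::real)"
    by (rule less_imp_neq[OF Gamma_real_pos, symmetric], simp)+
  ultimately show ?thesis
    using False ap0 by (simp add: oct_Z_def oct_branch_def \<Phi>\<^sub>2_def branch_ratio_def ap powr_minus divide_simps)
qed

lemma rational_on_oct_Z: "rational_on oct_S (oct_Z i j)"
proof (rule ladder_rational[where T = "\<lambda>i j u. - 27 * oct_v u * oct_Z (i + 2) (j + 1) u"])
  have "rational_on oct_S (\<lambda>u. Gamma (- 1 / 12) / Gamma (3 / 4))" by (rule rational_on_const)
  thus "rational_on oct_S (oct_Z 0 0)" by (subst rational_on_cong) (rule oct_Z_0_0)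
  \<comment> \<open>Since \<open>- 1\<close> is not in \<open>oct_S\<close>, near each point
    \<open>oct_Z\<close> is a single branch and inherits its derivative.\<close>
  have *: "2 * (- 27 * oct_v u * oct_Z (i + 2) (j + 1) u) + par_s i * oct_Z i j u = oct_e u * oct_Z (i + 1) j u \<and>
     - 27 * oct_v u * oct_Z (i + 2) (j + 1) u + (par_c j - 1) * oct_Z i j u = oct_Z i (j - 1) u \<and>
     (oct_Z i j has_field_derivative
       ((oct_f u)\<^sup>2 / (u * (1 - u)) * (- 27 * oct_v u * oct_Z (i + 2) (j + 1) u) -
         par_s i * (- 33 - 66 * u + 3 * u\<^sup>2) * oct_Z i j u) / oct_e u) (at u)"
    if u: "u \<in> oct_S" for i j u
  proof (cases "u > -1")
    case True
    hence "1 * oct_e u > 0" using oct_SD[OF u] by simp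
    note L = oct_branch_ladder[OF ladder_family_\<Phi>\<^sub>1 u disjI1[OF refl] this, where \<kappa> = 1 and i = i and j = j]
    have eq: "oct_Z i j u = oct_branch 1 1 \<Phi>\<^sub>1 i j u" for i j using True by (simp add: oct_Z_def)
    show ?thesis unfolding eq
      by (intro conjI L(1,2) has_field_derivative_transform_within_open[OF L(3), of "{-1<..}"])
         (use True in \<open>auto simp: oct_Z_def\<close>)
  next
    case False
    hence u1: "u < -1" "-1 * oct_e u > 0" using oct_SD[OF u] by auto
    note L = oct_branch_ladder[OF ladder_family_\<Phi>\<^sub>2 u disjI2[OF refl] u1(2), where \<kappa> = "branch_ratio" and i = i and j = j]
    have eq: "oct_Z i j u = oct_branch branch_ratio (-1) \<Phi>\<^sub>2 i j u" for i j using False by (simp add: oct_Z_def)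
    show ?thesis unfolding eq
      by (intro conjI L(1,2) has_field_derivative_transform_within_open[OF L(3), of "{..<-1}"])
         (use u1 in \<open>auto simp: oct_Z_def\<close>)
  qed
  fix i j u assume "u \<in> oct_S"
  from *[OF this, of i j] show
    "2 * (- 27 * oct_v u * oct_Z (i + 2) (j + 1) u) + par_s i * oct_Z i j u = oct_e u * oct_Z (i + 1) j u"
    "- 27 * oct_v u * oct_Z (i + 2) (j + 1) u + (par_c j - 1) * oct_Z i j u = oct_Z i (j - 1) u"
    "(oct_Z i j has_field_derivative
       ((oct_f u)\<^sup>2 / (u * (1 - u)) * (- 27 * oct_v u * oct_Z (i + 2) (j + 1) u) -
         par_s i * (- 33 - 66 * u + 3 * u\<^sup>2) * oct_Z i j u) / oct_e u) (at u)"
    by simp_all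
qed (use open_oct_S in auto)

subsection \<open>Identification with the octahedral functions\<close>

lemma hyp2F1_of_real:
  assumes "\<bar>x\<bar> < 1"
  shows "hyp2F1 (of_real a) (of_real b) (of_real c) (of_real x :: complex) = of_real (hyp2F1 a b c x)"
proof -
  have "summable (\<lambda>n. fps_nth (fps_hypergeo [a, b] [c] 1) n * x ^ n)"
    using assms by (intro summable_fps in_conv_ball_hypergeo_21) simp
  from suminf_of_real[OF this, where 'a = complex] show ?thesis
    by (simp add: hyp2F1_def eval_fps_def pochhammer_of_real)
qed

lemma p_e_R_oct_of_real:
  "p_e (of_real u) = of_real (oct_e u)" "R_oct (of_real u) = of_real (oct_R u)"
  by (simp_all add: p_e_def R_oct_def p_v_def oct_e_def oct_v_def oct_R_def)

text \<open>Uniqueness for the description in \<open>oct_r\<close>. Cross-multiplication gives a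
  polynomial identity, and coprimality forces the two denominators to vanish at the same points,
  where both functions have the value 0.\<close>

lemma rational_fun_eqI:
  assumes "rational_fun f" "rational_fun g" "\<forall>\<^sub>F w in at z. f w = g w"
  shows "f = g"
proof -
  from assms(1,2) obtain p q p' q' where
    f: "q \<noteq> 0" "coprime p q" "\<And>u. f u = poly p u / poly q u" and
    g: "q' \<noteq> 0" "coprime p' q'" "\<And>u. g u = poly p' u / poly q' u"
    unfolding rational_fun_def by metis
  have ev: "\<forall>\<^sub>F w in at z. poly h w \<noteq> 0" if "h \<noteq> 0" for h :: "complex poly"
    using islimpt_finite[OF poly_roots_finite[OF that], of z] by (simp add: islimpt_iff_eventually)
  have "p * q' = p' * q"
  proof (rule ccontr)
    assume "p * q' \<noteq> p' * q"
    hence "p * q' - p' * q \<noteq> 0" by simp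
    from ev[OF this] ev[OF f(1)] ev[OF g(1)] assms(3) have "\<forall>\<^sub>F w in at z. False"
      by eventually_elim (auto simp: f(3) g(3) divide_simps)
    thus False by simp
  qed
  hence cross: "poly p w * poly q' w = poly p' w * poly q w" for w by (metis poly_mult)
  show ?thesis
  proof
    fix w
    have "poly p w \<noteq> 0 \<or> poly q w \<noteq> 0" "poly p' w \<noteq> 0 \<or> poly q' w \<noteq> 0"
      using coprime_poly_0[OF f(2), of w] coprime_poly_0[OF g(2), of w] by auto
    with cross[of w] show "f w = g w" unfolding f(3) g(3) by (auto simp: divide_simps)
  qed
qed

text \<open>Bridges the two notions of rationality: \<open>rational_fun\<close> asks for a reduced
  quotient, \<open>rational_on\<close> does not.\<close>

lemma poly_coprime_reduction:
  fixes p q :: "'a :: field poly"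
  assumes "q \<noteq> 0"
  shows "\<exists>p' q' d. p = p' * d \<and> q = q' * d \<and> coprime p' q'"
  using assms
proof (induction "degree q" arbitrary: p q rule: less_induct)
  case less
  show ?case
  proof (cases "coprime p q")
    case True
    then show ?thesis by (intro exI[of _ p] exI[of _ q] exI[of _ 1]) simp
  next
    case False
    then obtain r where r: "r dvd p" "r dvd q" "\<not> is_unit r"
      by (auto simp: coprime_def)
    then obtain p1 q1 where pq: "p = p1 * r" "q = q1 * r" by (metis dvd_def mult.commute)
    with less.prems have nz: "q1 \<noteq> 0" "r \<noteq> 0" by auto
    with r(3) have "degree r > 0" by (simp add: is_unit_iff_degree)
    with nz have "degree q1 < degree q" by (simp add: pq degree_mult_eq)
    from less.hyps[OF this nz(1)] obtain p' q' d where "p1 = p' * d" "q1 = q' * d" "coprime p' q'"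
      by blast
    then show ?thesis unfolding pq by (intro exI[of _ p'] exI[of _ q'] exI[of _ "d * r"]) (simp add: mult_ac)
  qed
qed

lemma poly_map_poly_of_real:
  "poly (map_poly of_real p) (of_real x :: 'a :: {real_algebra_1, comm_ring_1}) = of_real (poly p x)"
  by (induction p) (auto simp: map_poly_pCons)

text \<open>The quotient describing \<open>oct_Z\<close> on all of \<open>oct_S\<close> is compared
  with the definition of \<open>oct_r\<close> along \<open>oct_I\<close> only, whose points
  accumulate at \<open>0\<close>. As the same quotient holds for \<open>u < - 1\<close>, the
  conclusion extends to that component. The Gamma factors undo the normalization of
  \<open>\<Phi>\<^sub>1\<close>.\<close>

lemma oct_r_of_real:
  fixes n m :: int
  assumes u: "u \<in> oct_S"
  shows "oct_r n m (of_real u) =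
           of_real (Gamma (par_c (- m)) / Gamma (par_s (- m - n)) * oct_Z (- m - n) (- m) u)"
proof -
  define s where "s = par_s (- m - n)"
  define c where "c = par_c (- m)"
  define G where "G = Gamma c / Gamma s"
  define F where "F = (\<lambda>w :: complex. hyp2F1 (of_real (s / 2)) (of_real (s / 2 + 1 / 2)) (of_real c) w)"
  obtain p q where pq: "\<And>u. u \<in> oct_S \<Longrightarrow> poly q u \<noteq> 0"
    "\<And>u. u \<in> oct_S \<Longrightarrow> oct_Z (- m - n) (- m) u = poly p u / poly q u"
    using rational_onE[OF rational_on_oct_Z] by metis
  define pc qc :: "complex poly"
    where "pc = map_poly of_real (smult G p)" and "qc = map_poly of_real q"
  have qc: "poly qc (of_real t) = of_real (poly q t)"
    and pc: "poly pc (of_real t) = of_real (G * poly p t)" for t :: real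
    unfolding pc_def qc_def by (simp_all only: poly_map_poly_of_real poly_smult)
  have "qc \<noteq> 0" using pq(1)[OF u] qc[of u] by auto
  then obtain p0 q0 d where 0: "pc = p0 * d" "qc = q0 * d" "coprime p0 q0"
    using poly_coprime_reduction by metis
  with \<open>qc \<noteq> 0\<close> have q0: "q0 \<noteq> 0" by auto
  define r0 where "r0 = (\<lambda>w. poly p0 w / poly q0 w)"
  have rat: "rational_fun r0" unfolding rational_fun_def r0_def using q0 0(3) by blast
  have r0: "r0 (of_real t) = of_real (G * oct_Z (- m - n) (- m) t)" "poly q0 (of_real t) \<noteq> 0" if t: "t \<in> oct_S" for t
  proof -
    have "poly d (of_real t) \<noteq> 0" "poly q0 (of_real t) \<noteq> 0"
      using pq(1)[OF t] qc[of t] unfolding 0 by auto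
    hence "r0 (of_real t) = poly pc (of_real t) / poly qc (of_real t)"
      unfolding 0 r0_def by simp
    thus "r0 (of_real t) = of_real (G * oct_Z (- m - n) (- m) t)" "poly q0 (of_real t) \<noteq> 0"
      using \<open>poly q0 (of_real t) \<noteq> 0\<close> unfolding pc qc pq(2)[OF t] by simp_all
  qed
  have conv: "isCont R_oct 0" "isCont p_e 0" "R_oct 0 = 0" "p_e 0 = 1"
    unfolding R_oct_def[abs_def] p_e_def p_v_def by (auto intro!: continuous_intros)
  have "\<forall>\<^sub>F w in nhds 0. norm (R_oct w) < 1 \<and> Re (p_e w) > 0"
  proof (intro eventually_conj)
    have l: "(R_oct \<longlongrightarrow> 0) (nhds 0)" "(p_e \<longlongrightarrow> 1) (nhds 0)"
      using conv by (metis isCont_def tendsto_at_iff_tendsto_nhds)+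
    show "\<forall>\<^sub>F w in nhds 0. norm (R_oct w) < 1"
      using order_tendstoD(2)[OF tendsto_norm[OF l(1)], of 1] by simp
    show "\<forall>\<^sub>F w in nhds 0. Re (p_e w) > 0"
      using order_tendstoD(1)[OF tendsto_Re[OF l(2)], of 0] by simp
  qed
  then obtain \<delta> where \<delta>: "\<delta> > 0" "\<And>w. w \<in> ball 0 \<delta> \<Longrightarrow> norm (R_oct w) < 1 \<and> Re (p_e w) > 0"
    by (auto simp: eventually_nhds_metric dist_commute)
  \<comment> \<open>Denominators are cleared, because \<open>q0\<close> is not yet known to be
    nonzero at and around \<open>0\<close>.\<close>
  define H where "H = (\<lambda>w. poly q0 w * F (R_oct w) - p_e w powr (of_real s) * poly p0 w)"
  have H0: "H w = 0" if w: "w \<in> ball 0 \<delta>" for w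
  proof (rule analytic_continuation[of H "ball 0 \<delta>" "of_real ` (oct_I \<inter> ball 0 \<delta>)" 0])
    have e: "p_e z \<noteq> 0" "p_e z \<notin> \<real>\<^sub>\<le>\<^sub>0" if "z \<in> ball 0 \<delta>" for z
      using \<delta>(2)[OF that] by (auto simp: complex_nonpos_Reals_iff)
    have R: "R_oct holomorphic_on ball 0 \<delta>" "p_e holomorphic_on ball 0 \<delta>"
      unfolding R_oct_def[abs_def] p_v_def using e
      by (auto intro!: holomorphic_intros) (auto intro!: holomorphic_intros simp: p_e_def[abs_def])
    have "F field_differentiable (at (R_oct z) within R_oct ` ball 0 \<delta>)" if "z \<in> ball 0 \<delta>" for z
      unfolding F_def
      by (rule field_differentiable_at_within, unfold field_differentiable_def, rule exI,
          rule has_field_derivative_hyp2F1) (use \<delta>(2)[OF that] in auto)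
    hence "F holomorphic_on R_oct ` ball 0 \<delta>" by (auto simp: holomorphic_on_def)
    from holomorphic_on_compose[OF R(1) this] have "(\<lambda>w. F (R_oct w)) holomorphic_on ball 0 \<delta>"
      by (simp add: o_def)
    thus "H holomorphic_on ball 0 \<delta>"
      unfolding H_def using R e by (intro holomorphic_intros) auto
    show "(0 :: complex) islimpt of_real ` (oct_I \<inter> ball 0 \<delta>)"
    proof (rule islimptI)
      fix T :: "complex set" assume T: "0 \<in> T" "open T"
      then obtain e where e: "e > 0" "ball 0 e \<subseteq> T" by (meson openE)
      define M where "M = min (min e \<delta>) (7 - 4 * sqrt 3)"
      have "M > 0" "M \<le> e" "M \<le> \<delta>" "M \<le> 7 - 4 * sqrt 3"
        using e \<delta> sqrt3_bounds by (simp_all add: M_def)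
      moreover define t where "t = - (M / 2)"
      ultimately have "t < 0" "t > 4 * sqrt 3 - 7" "\<bar>t\<bar> < e" "\<bar>t\<bar> < \<delta>" by linarith+
      thus "\<exists>y\<in>of_real ` (oct_I \<inter> ball 0 \<delta>). y \<in> T \<and> y \<noteq> 0"
        using e(2) by (intro bexI[of _ "of_real t"]) (auto simp: oct_I_def)
    qed
    fix z :: complex assume "z \<in> of_real ` (oct_I \<inter> ball 0 \<delta>)"
    then obtain t where t: "z = of_real t" "t \<in> oct_I" by auto
    hence tS: "t \<in> oct_S" "t > -1" by (simp_all add: oct_I_iff)
    have e: "oct_e t > 0" using oct_SD[OF tS(1)] tS by simp
    have x: "\<bar>oct_R t\<bar> < 1" using oct_R_bounds[OF tS(1)] by simp
    have Gs: "Gamma s \<noteq> 0" "Gamma c \<noteq> 0" unfolding s_def c_def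
      by (intro Gamma_neq_0_notin_Ints par_notin_Ints)+
    have "oct_Z (- m - n) (- m) t = \<Phi>\<^sub>1 s c (oct_R t) * oct_e t powr (- s)"
      unfolding s_def c_def using tS by (simp add: oct_Z_def oct_branch_def)
    moreover have "oct_e t powr s * oct_e t powr (- s) = 1" using e by (simp flip: powr_add)
    ultimately have L: "oct_e t powr s * (G * oct_Z (- m - n) (- m) t) = legendre_2F1 s c (oct_R t)"
      using Gs by (simp add: G_def \<Phi>\<^sub>1_def)
    have F: "F (R_oct z) = of_real (legendre_2F1 s c (oct_R t))"
      unfolding F_def t p_e_R_oct_of_real legendre_2F1_def by (rule hyp2F1_of_real[OF x])
    have P: "p_e z powr of_real s = of_real (oct_e t powr s)"
      unfolding t p_e_R_oct_of_real using e by (simp add: powr_of_real)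
    have r: "r0 z = of_real (G * oct_Z (- m - n) (- m) t)"
      unfolding t(1) by (rule r0(1)[OF tS(1)])
    have "F (R_oct z) = p_e z powr of_real s * r0 z"
      unfolding F P r L[symmetric] by (rule of_real_mult)
    moreover have "poly p0 z = r0 z * poly q0 z" using r0(2)[OF tS(1)] by (simp add: r0_def t)
    ultimately show "H z = 0" by (simp add: H_def)
  qed (use \<delta>(1) w in auto)
  have ev0: "\<forall>\<^sub>F w in nhds 0. p_e w \<noteq> 0 \<and> F (R_oct w) = p_e w powr (of_real s) * r0 w"
    unfolding eventually_nhds_metric
  proof (intro exI[of _ \<delta>] conjI allI impI \<delta>(1))
    fix w :: complex assume "dist w 0 < \<delta>"
    hence w: "w \<in> ball 0 \<delta>" by simp
    show e: "p_e w \<noteq> 0" using \<delta>(2)[OF w] by auto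
    have "poly q0 w * F (R_oct w) = p_e w powr (of_real s) * poly p0 w"
      using H0[OF w] by (simp add: H_def)
    \<comment> \<open>At a zero of \<open>q0\<close> the equation and
      \<open>p_e w \<noteq> 0\<close> would give \<open>poly p0 w = 0\<close>, against
      coprimality.\<close>
    moreover have "poly q0 w \<noteq> 0"
      using calculation e coprime_poly_0[OF 0(3), of w] by auto
    ultimately show "F (R_oct w) = p_e w powr (of_real s) * r0 w"
      by (simp add: r0_def nonzero_eq_divide_eq mult.commute)
  qed
  have s2: "s / 2 = - 1/24 - real_of_int m / 2 - real_of_int n / 2"
    by (simp add: s_def)
  have s3: "s / 2 + 1 / 2 = 11/24 - real_of_int m / 2 - real_of_int n / 2"
    unfolding s2 by simp
  have sc: "c = 3/4 - real_of_int m" "s = - 1/12 - real_of_int m - real_of_int n"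
    by (simp_all add: s_def c_def)
  have par: "- 1/24 - of_int m / 2 - of_int n / 2 = complex_of_real (s / 2)"
    unfolding s2 by simp
  have par2: "11/24 - of_int m / 2 - of_int n / 2 = complex_of_real (s / 2 + 1 / 2)"
    unfolding s3 by simp
  have par3: "3/4 - of_int m = complex_of_real c"
    unfolding sc by simp
  have par4: "- 1/12 - of_int m - of_int n = complex_of_real s"
    unfolding sc by simp
  have "oct_r n m = r0"
    unfolding oct_r_def par par2 par3 par4
  proof (rule the_equality, intro conjI rat)
    show "\<forall>\<^sub>F u in nhds 0. hyp2F1 (complex_of_real (s / 2)) (complex_of_real (s / 2 + 1 / 2))
           (complex_of_real c) (R_oct u) = p_e u powr complex_of_real s * r0 u"
      using ev0 by eventually_elim (simp add: F_def)
  next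
    fix r
    assume r: "rational_fun r \<and> (\<forall>\<^sub>F u in nhds 0. hyp2F1 (complex_of_real (s / 2)) (complex_of_real (s / 2 + 1 / 2))
           (complex_of_real c) (R_oct u) = p_e u powr complex_of_real s * r u)"
    hence "\<forall>\<^sub>F u in nhds 0. F (R_oct u) = p_e u powr complex_of_real s * r u"
      by (simp add: F_def)
    with ev0 have "\<forall>\<^sub>F u in nhds 0. r u = r0 u"
      by eventually_elim auto
    hence "\<forall>\<^sub>F u in at 0. r u = r0 u" by (simp add: eventually_nhds_conv_at)
    with r rat show "r = r0" by (intro rational_fun_eqI) auto
  qed
  with r0(1)[OF u] show ?thesis by (simp add: G_def s_def c_def)
qed

subsection \<open>Values of the Gamma function\<close>

lemma Gamma_reflection_real: "Gamma (x :: real) * Gamma (1 - x) = pi / sin (pi * x)"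
proof -
  have "complex_of_real (Gamma x * Gamma (1 - x)) = complex_of_real (pi / sin (pi * x))"
    using Gamma_reflection_complex[of "of_real x"]
    by (simp only: of_real_mult of_real_divide of_real_diff of_real_1 Gamma_complex_of_real[symmetric]
        sin_of_real[symmetric])
  thus ?thesis by (simp only: of_real_eq_iff)
qed

lemma Gamma_legendre_duplication_real:
  assumes "x > (0 :: real)"
  shows "Gamma x * Gamma (x + 1 / 2) = 2 powr (1 - 2 * x) * sqrt pi * Gamma (2 * x)"
proof -
  have "complex_of_real x \<notin> \<int>\<^sub>\<le>\<^sub>0" "complex_of_real x + 1 / 2 \<notin> \<int>\<^sub>\<le>\<^sub>0"
    using assms by (auto elim!: nonpos_Ints_cases simp: complex_eq_iff)
  from Gamma_legendre_duplication[OF this]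
  have "complex_of_real (Gamma x * Gamma (x + 1 / 2)) =
          complex_of_real (exp ((1 - 2 * x) * ln 2) * sqrt pi * Gamma (2 * x))"
    by (simp only: of_real_mult of_real_divide of_real_diff of_real_add of_real_1 of_real_numeral
        Gamma_complex_of_real[symmetric] exp_of_real[symmetric])
  thus ?thesis by (simp only: of_real_eq_iff) (simp add: powr_def)
qed

lemma pochhammer_triple:
  "pochhammer (3 * z) (3 * n) =
     27 ^ n * pochhammer z n * pochhammer (z + 1 / 3) n * pochhammer (z + 2 / 3 :: real) n"
proof (induction n)
  case (Suc n)
  have "3 * Suc n = Suc (Suc (Suc (3 * n)))" by simp
  hence "pochhammer (3 * z) (3 * Suc n) =
    pochhammer (3 * z) (3 * n) * (3 * z + 3 * real n) * (3 * z + (3 * real n + 1)) * (3 * z + (3 * real n + 2))"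
    by (simp only: pochhammer_Suc) (simp add: add_ac)
  also have "\<dots> = pochhammer (3 * z) (3 * n) * (27 * ((z + n) * (z + 1 / 3 + n) * (z + 2 / 3 + n)))"
    by (simp add: field_simps)
  finally show ?case unfolding Suc.IH pochhammer_Suc power_Suc by (simp only: mult_ac)
qed simp

text \<open>
  The point is that the left-hand side does not depend on \<open>z\<close>, so that the limit can be read off at
  \<open>z = 1 / 3\<close> and Stirling's formula is not needed.
\<close>

lemma Gamma_triplication_limit:
  assumes "z > (0 :: real)"
  shows "(\<lambda>n. fact n ^ 3 * 27 ^ (n + 1) * real n / fact (3 * n + 2)) \<longlonglongrightarrow>
           Gamma z * Gamma (z + 1 / 3) * Gamma (z + 2 / 3) / Gamma (3 * z) * 3 powr (3 * z)"
proof -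
  \<comment> \<open>\<open>Gamma_series z N\<close> contains \<open>pochhammer z (N + 1)\<close>.
    The index \<open>3 * n + 2\<close> makes this length \<open>3 * (n + 1)\<close>, as
    \<open>pochhammer_triple\<close> requires.\<close>
  define Q where "Q = (\<lambda>n. Gamma_series z n * Gamma_series (z + 1 / 3) n * Gamma_series (z + 2 / 3) n /
      Gamma_series (3 * z) (3 * n + 2))"
  have G: "Gamma (3 * z) \<noteq> 0" using Gamma_real_pos[of "3 * z"] assms by (simp del: Gamma_real_pos)
  have "filterlim (\<lambda>n. 3 * n + 2 :: nat) sequentially sequentially"
    by (rule filterlim_subseq) (simp add: strict_mono_def)
  hence "(\<lambda>n. Gamma_series (3 * z) (3 * n + 2)) \<longlonglongrightarrow> Gamma (3 * z)"
    by (rule filterlim_compose[OF Gamma_series_LIMSEQ])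
  hence Q: "Q \<longlonglongrightarrow> Gamma z * Gamma (z + 1 / 3) * Gamma (z + 2 / 3) / Gamma (3 * z)"
    unfolding Q_def using G by (intro tendsto_intros Gamma_series_LIMSEQ)
  have "(\<lambda>n. 3 + 2 * (1 / real n)) \<longlonglongrightarrow> 3 + 2 * 0"
    by (intro tendsto_intros lim_1_over_n)
  hence "(\<lambda>n. (3 + 2 * (1 / real n)) powr (3 * z)) \<longlonglongrightarrow> (3 + 2 * 0) powr (3 * z)"
    by (intro tendsto_powr) auto
  from tendsto_mult[OF Q this]
  have "(\<lambda>n. Q n * (3 + 2 * (1 / real n)) powr (3 * z)) \<longlonglongrightarrow>
           Gamma z * Gamma (z + 1 / 3) * Gamma (z + 2 / 3) / Gamma (3 * z) * 3 powr (3 * z)"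
    by simp
  moreover have "\<forall>\<^sub>F n in sequentially. Q n * (3 + 2 * (1 / real n)) powr (3 * z) =
      fact n ^ 3 * 27 ^ (n + 1) * real n / fact (3 * n + 2)"
    using eventually_gt_at_top[of 0]
  proof eventually_elim
    case (elim n)
    define k where "k = real n"
    have k: "k > 0" using elim by (simp add: k_def)
    define a b c where "a = pochhammer z (n + 1)" and "b = pochhammer (z + 1 / 3) (n + 1)"
      and "c = pochhammer (z + 2 / 3) (n + 1)"
    have abc: "a > 0" "b > 0" "c > 0" unfolding a_def b_def c_def using assms by (auto intro!: pochhammer_pos)
    have e: "exp (w * of_real (ln (of_nat n))) = k powr w" for w :: real
      using k by (simp add: k_def powr_def)
    have N: "3 * n + 2 + 1 = 3 * (n + 1)" by simp
    have "exp (3 * z * of_real (ln (of_nat (3 * n + 2)))) = (3 * k + 2) powr (3 * z)"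
      using k by (simp add: k_def powr_def add.commute)
    moreover have "3 * k + 2 = (3 + 2 * (1 / k)) * k" using k by (simp add: field_simps)
    hence "(3 * k + 2) powr (3 * z) = (3 + 2 * (1 / k)) powr (3 * z) * k powr (3 * z)"
      using k by (simp add: powr_mult)
    ultimately have d: "Gamma_series (3 * z) (3 * n + 2) =
        fact (3 * n + 2) * ((3 + 2 * (1 / k)) powr (3 * z) * k powr (3 * z)) / (27 ^ (n + 1) * a * b * c)"
      unfolding Gamma_series_def N pochhammer_triple a_def[symmetric] b_def[symmetric] c_def[symmetric] by simp
    have "k powr z * k powr (z + 1 / 3) * k powr (z + 2 / 3) = k powr (3 * z + 1)"
      by (simp flip: powr_add)
    also have "\<dots> = k powr (3 * z) * k" using k by (simp add: powr_add)
    finally have n: "Gamma_series z n * Gamma_series (z + 1 / 3) n * Gamma_series (z + 2 / 3) n =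
        fact n ^ 3 * (k powr (3 * z) * k) / (a * b * c)"
      unfolding Gamma_series_def e a_def[symmetric] b_def[symmetric] c_def[symmetric]
      by (simp add: power3_eq_cube mult_ac)
    define q where "q = (3 + 2 * (1 / k)) powr (3 * z)"
    have "2 / k > 0" using k by simp
    hence "3 + 2 / k \<noteq> 0" by linarith
    hence q: "q > 0" by (simp add: q_def)
    have "k powr (3 * z) > 0" using k by simp
    have key: "X * (k3 * k) / (a * b * c) / (Y * (q * k3) / (M * a * b * c)) * q = X * M * k / Y"
      if "k3 > 0" "Y > 0" "M > 0" for X Y M k3 :: real
      using that abc k q by simp
    show ?case
      unfolding Q_def n d k_def[symmetric] q_def[symmetric] by (rule key) (use k in simp_all)
  qed
  ultimately show ?thesis by (rule Lim_transform_eventually)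
qed

lemma Gamma_one_third_two_thirds: "Gamma (1 / 3 :: real) * Gamma (2 / 3) = 2 * pi / sqrt 3"
  using Gamma_reflection_real[of "1 / 3"] sin_60 by (simp add: field_simps)

lemma Gamma_triplication_real:
  assumes "z > (0 :: real)"
  shows "Gamma z * Gamma (z + 1 / 3) * Gamma (z + 2 / 3) = 2 * sqrt 3 * pi * 3 powr (- 3 * z) * Gamma (3 * z)"
proof -
  have "Gamma z * Gamma (z + 1 / 3) * Gamma (z + 2 / 3) / Gamma (3 * z) * 3 powr (3 * z) =
     Gamma (1 / 3) * Gamma (1 / 3 + 1 / 3) * Gamma (1 / 3 + 2 / 3) / Gamma (3 * (1 / 3)) * 3 powr (3 * (1 / 3))"
    using LIMSEQ_unique[OF Gamma_triplication_limit[OF assms] Gamma_triplication_limit[of "1 / 3"]] by simp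
  also have "\<dots> = (2 * pi / sqrt 3) * 3"
    using Gamma_one_third_two_thirds by simp
  also have "\<dots> = 2 * sqrt 3 * pi" by (simp add: field_simps)
  finally have "Gamma z * Gamma (z + 1 / 3) * Gamma (z + 2 / 3) / Gamma (3 * z) * 3 powr (3 * z) = 2 * sqrt 3 * pi" .
  hence "Gamma z * Gamma (z + 1 / 3) * Gamma (z + 2 / 3) * (3 powr (3 * z) * 3 powr (- 3 * z)) =
      2 * sqrt 3 * pi * 3 powr (- 3 * z) * Gamma (3 * z)"
    using less_imp_neq[OF Gamma_real_pos[of "3 * z"]] assms by (simp add: nonzero_divide_eq_eq mult_ac)
  moreover have "3 powr (3 * z) * 3 powr (- 3 * z) = 1" by (simp flip: powr_add)
  ultimately show ?thesis by (simp only: mult_1_right)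
qed

text \<open>Triplication at 1/4, duplication at 5/12 and 1/3, and reflection at 5/12, 1/3 and 1/4
  determine the square of the first quotient; positivity determines the root. The factor
  \<open>sqrt 3 + 1\<close> comes from sin (5 pi / 12).\<close>

lemma Gamma_11_12: "Gamma (11 / 12) * Gamma (1 / 3) / Gamma (3 / 4) =
    2 powr (1 / 4) * sqrt pi * 3 powr (- 3 / 8) * sqrt (sqrt 3 + 1)" (is "?L = ?R")
  and Gamma_5_12: "Gamma (5 / 12) * Gamma (1 / 3) / Gamma (1 / 4) =
    2 powr (1 / 4) * sqrt pi * 3 powr (- 1 / 8) * sqrt (sqrt 3 - 1)" (is "?L' = ?R'")
proof -
  define b c d g g' h h' k where gam: "b = Gamma (5 / 12 :: real)" "c = Gamma (7 / 12 :: real)" "d = Gamma (11 / 12 :: real)"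
    "g = Gamma (1 / 3 :: real)" "g' = Gamma (2 / 3 :: real)" "h = Gamma (1 / 4 :: real)" "h' = Gamma (3 / 4 :: real)"
    "k = Gamma (5 / 6 :: real)"
  have pos: "b > 0" "c > 0" "d > 0" "g > 0" "g' > 0" "h > 0" "h' > 0" "k > 0"
    unfolding gam by (simp_all add: Gamma_real_pos)
  define \<sigma> where "\<sigma> = sin (5 * pi / 12)"
  have "\<sigma> = sin (pi / 4 + pi / 6)" by (simp add: \<sigma>_def)
  also have "\<dots> = sqrt 2 * (sqrt 3 + 1) / 4"
    unfolding sin_add sin_45 cos_45 sin_30 cos_30 by (simp add: field_simps)
  finally have \<sigma>: "\<sigma> = sqrt 2 * (sqrt 3 + 1) / 4" .
  have \<sigma>0: "\<sigma> > 0" unfolding \<sigma> by (simp add: add_pos_pos)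
  have E1: "h * c * d = 2 * sqrt 3 * pi * 3 powr (- 3 / 4) * h'"
    using Gamma_triplication_real[of "1 / 4"] by (simp add: gam)
  have E2: "b * d = 2 powr (1 / 6) * sqrt pi * k"
    using Gamma_legendre_duplication_real[of "5 / 12"] by (simp add: gam)
  have E3: "b * c * \<sigma> = pi"
    using Gamma_reflection_real[of "5 / 12"] \<sigma>0 by (simp add: gam \<sigma>_def field_simps)
  have E4: "g * k = 2 powr (1 / 3) * sqrt pi * g'"
    using Gamma_legendre_duplication_real[of "1 / 3"] by (simp add: gam)
  have E5: "g * g' * sqrt 3 = 2 * pi"
    using Gamma_one_third_two_thirds by (simp add: gam field_simps)
  have E6: "h * h' = pi * sqrt 2"
  proof -
    have "h * h' = pi / (sqrt 2 / 2)"
      using Gamma_reflection_real[of "1 / 4"] sin_45 by (simp add: gam)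
    also have "\<dots> = pi * (2 / sqrt 2)" by simp
    also have "2 / sqrt 2 = sqrt 2" by (rule real_div_sqrt) simp
    finally show ?thesis .
  qed
  have p2: "2 powr (1 / 6) * 2 powr (1 / 3) = sqrt 2"
    by (simp add: powr_half_sqrt flip: powr_add)
  have bd: "b * d * g\<^sup>2 * sqrt 3 = sqrt 2 * 2 * pi\<^sup>2"
  proof -
    have "b * d * g\<^sup>2 * sqrt 3 = 2 powr (1 / 6) * sqrt pi * (g * k) * g * sqrt 3"
      unfolding E2 by (simp add: power2_eq_square)
    also have "\<dots> = (2 powr (1 / 6) * 2 powr (1 / 3)) * (sqrt pi * sqrt pi) * (g * g' * sqrt 3)"
      unfolding E4 by (simp only: mult_ac)
    also have "\<dots> = sqrt 2 * 2 * pi\<^sup>2" unfolding p2 E5 by (simp add: power2_eq_square)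
    finally show ?thesis .
  qed
  have X2: "(d * g / h')\<^sup>2 = sqrt 2 * pi * 3 powr (- 3 / 4) * (sqrt 3 + 1)"
  proof -
    have "(d * g)\<^sup>2 * (h * h') * (b * c * \<sigma>) * sqrt 3 = (h * c * d) * (b * d * g\<^sup>2 * sqrt 3) * \<sigma> * h'"
      by (simp add: power2_eq_square)
    hence "(d * g)\<^sup>2 * (pi * sqrt 2) * pi * sqrt 3 =
        (2 * sqrt 3 * pi * 3 powr (- 3 / 4) * h') * (sqrt 2 * 2 * pi\<^sup>2) * \<sigma> * h'"
      unfolding E6 E3 E1 bd .
    hence "(d * g)\<^sup>2 * (pi\<^sup>2 * sqrt 2 * sqrt 3) = (4 * pi * 3 powr (- 3 / 4) * \<sigma> * h'\<^sup>2) * (pi\<^sup>2 * sqrt 2 * sqrt 3)"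
      by (simp add: power2_eq_square mult_ac)
    hence "(d * g)\<^sup>2 = 4 * pi * 3 powr (- 3 / 4) * \<sigma> * h'\<^sup>2" by simp
    thus ?thesis unfolding power_divide \<sigma> using pos by simp
  qed
  have R2: "?R\<^sup>2 = sqrt 2 * pi * 3 powr (- 3 / 4) * (sqrt 3 + 1)"
  proof -
    have "(2 powr (1 / 4))\<^sup>2 = sqrt (2 :: real)" "(3 powr (- 3 / 8))\<^sup>2 = (3 :: real) powr (- 3 / 4)"
      by (simp_all add: power2_eq_square powr_half_sqrt flip: powr_add)
    moreover have "(sqrt (sqrt 3 + 1))\<^sup>2 = sqrt 3 + 1" by (simp add: add_nonneg_nonneg)
    ultimately show ?thesis by (simp add: power_mult_distrib)
  qed
  have "?L\<^sup>2 = ?R\<^sup>2" using X2 R2 by (simp add: gam)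
  moreover have "?L \<ge> 0" using pos by (simp add: gam)
  moreover have "?R \<ge> 0" by simp
  ultimately show LR: "?L = ?R" by (rule power2_eq_imp_eq)
  \<comment> \<open>The second quotient is obtained from its product with the first, where
    \<open>(sqrt 3 + 1) * (sqrt 3 - 1) = 2\<close>.\<close>
  have RR: "?R * ?R' * sqrt 3 = 2 * pi"
  proof -
    have a: "2 powr (1 / 4) * 2 powr (1 / 4) = sqrt (2 :: real)" "3 powr (- 3 / 8) * 3 powr (- 1 / 8) = 1 / sqrt (3 :: real)"
      by (simp_all add: powr_half_sqrt powr_minus_divide flip: powr_add)
    have "sqrt (sqrt 3 + 1) * sqrt (sqrt 3 - 1) = sqrt ((sqrt 3 + 1) * (sqrt 3 - 1))"
      by (simp only: real_sqrt_mult)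
    also have "(sqrt 3 + 1) * (sqrt 3 - 1) = (2 :: real)" by (simp add: algebra_simps)
    finally have b: "sqrt (sqrt 3 + 1) * sqrt (sqrt 3 - 1) = sqrt 2" .
    have "?R * ?R' * sqrt 3 = (2 powr (1 / 4) * 2 powr (1 / 4)) * (3 powr (- 3 / 8) * 3 powr (- 1 / 8)) *
        (sqrt (sqrt 3 + 1) * sqrt (sqrt 3 - 1)) * (sqrt pi * sqrt pi) * sqrt 3"
      by (simp only: mult_ac)
    thus ?thesis unfolding a b by simp
  qed
  have LL: "?L * ?L' * sqrt 3 = 2 * pi"
  proof -
    have "?L * ?L' * sqrt 3 = (b * d * g\<^sup>2 * sqrt 3) / (h * h')"
      by (simp add: gam power2_eq_square mult_ac)
    thus ?thesis unfolding bd E6 by (simp add: power2_eq_square)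
  qed
  have "d * g / h' \<noteq> 0" using pos by simp
  hence nz: "?L \<noteq> 0" "sqrt 3 \<noteq> (0 :: real)" unfolding gam by simp_all
  have "?L * (?L' * sqrt 3) = ?L * (?R' * sqrt 3)"
    using LL RR unfolding LR by (simp only: mult.assoc)
  hence "?L' * sqrt 3 = ?R' * sqrt 3"
    using mult_left_cancel[OF nz(1), of "?L' * sqrt 3" "?R' * sqrt 3"] by blast
  thus "?L' = ?R'"
    using mult_right_cancel[OF nz(2), of "?L'" "?R'"] by blast
qed

section \<open>Rising factorials and Gamma values at integer shifts\<close>

lemma rising_fact_plus1:
  fixes d :: real
  assumes "d \<notin> \<int>"
  shows "rising_fact d (k + 1) = rising_fact d k * (d + of_int k)"
proof (cases "k \<ge> 0")
  case True
  then obtain j where k: "k = int j" by (metis nonneg_int_cases)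
  have "nat (int j + 1) = Suc j" by simp
  thus ?thesis unfolding k rising_fact_def by (simp add: pochhammer_Suc)
next
  case False
  then obtain j where j: "nat (- k) = Suc j" "k = - int (Suc j)" by (intro that[of "nat (- k) - 1"]) auto
  have nz: "d + of_int k \<noteq> 0"
    using assms by (metis Ints_minus Ints_of_int add_eq_0_iff2)
  have "rising_fact d (k + 1) = inverse (\<Prod>i = 1..j. d - of_nat i)"
    by (cases "j = 0") (auto simp: rising_fact_def j)
  moreover have "rising_fact d k = inverse ((\<Prod>i = 1..j. d - of_nat i) * (d + of_int k))"
    unfolding rising_fact_def j(1) using False j by (simp add: prod.nat_ivl_Suc')
  ultimately show ?thesis using nz by simp
qed

lemma rising_fact_neq_0:
  fixes d :: real
  assumes "d \<notin> \<int>"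
  shows "rising_fact d k \<noteq> 0"
proof -
  have nz: "d + of_int j \<noteq> 0" for j :: int
    using assms by (metis Ints_minus Ints_of_int add_eq_0_iff2)
  show ?thesis
  proof (induction k rule: int_induct[where k = 0])
    case (step1 i)
    then show ?case using rising_fact_plus1[OF assms, of i] nz by simp
  next
    case (step2 i)
    then show ?case using rising_fact_plus1[OF assms, of "i - 1"] by auto
  qed (simp add: rising_fact_def)
qed

lemma Gamma_minus_int:
  fixes x :: real
  assumes "x \<notin> \<int>"
  shows "Gamma (x - of_int k) * rising_fact (1 - x) k = (- 1) powi k * Gamma x"
proof -
  have x1: "1 - x \<notin> \<int>" using assms Ints_diff[of 1 "1 - x"] by auto
  have xk: "x - of_int k \<notin> \<int>" for k using assms by simp
  have G: "Gamma (x - of_int k) = (x - of_int k - 1) * Gamma (x - of_int (k + 1))" for k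
    using Gamma_plus1_notin_Ints[OF xk, of "k + 1"] by (simp add: algebra_simps)
  have step: "Gamma (x - of_int (k + 1)) * rising_fact (1 - x) (k + 1) =
      - (Gamma (x - of_int k) * rising_fact (1 - x) k)" for k
    unfolding rising_fact_plus1[OF x1] G[of k] by (simp add: algebra_simps)
  show ?thesis
  proof (induction k rule: int_induct[where k = 0])
    case (step1 i)
    have "(- 1 :: real) powi (i + 1) = - ((- 1) powi i)" by (simp add: power_int_add)
    then show ?case unfolding step step1.IH by simp
  next
    case (step2 i)
    have "(- 1 :: real) powi i = - ((- 1) powi (i - 1))" by (simp add: power_int_diff)
    then show ?case using step[of "i - 1"] step2.IH by simp
  qed (simp add: rising_fact_def)
qed

text \<open>The bases in \<open>C_oct\<close> arise as \<open>13/12 = 1 - (- 1/12)\<close> and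
  \<open>1/4 = 1 - 3/4\<close>. Of the signs \<open>(- 1) powi (m + n)\<close> and
  \<open>(- 1) powi m\<close> the product \<open>(- 1) powi n\<close> remains.\<close>

lemma Gamma_quotient_par:
  fixes n m :: int
  shows "Gamma (par_s (- m - n)) / Gamma (par_c (- m)) =
    (- 1) powi n * (Gamma (- 1 / 12) / Gamma (3 / 4)) * rising_fact (1 / 4) m * inverse (rising_fact (13 / 12) (m + n))"
proof -
  have ni: "- 1 / 12 \<notin> (\<int> :: real set)" "3 / 4 \<notin> (\<int> :: real set)"
    using par_notin_Ints(1)[of 0] par_notin_Ints(2)[of 0] by simp_all
  have ni': "13 / 12 \<notin> (\<int> :: real set)" "1 / 4 \<notin> (\<int> :: real set)"
    using Ints_diff[of 1 "13 / 12 :: real"] Ints_diff[of 1 "1 / 4 :: real"] ni by auto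
  have par: "par_s (- m - n) = - 1 / 12 - of_int (m + n)" "par_c (- m) = 3 / 4 - of_int m"
    by simp_all
  have "Gamma (par_s (- m - n)) * rising_fact (13 / 12) (m + n) = (- 1) powi (m + n) * Gamma (- 1 / 12)"
    using Gamma_minus_int[OF ni(1), of "m + n"] unfolding par by simp
  hence 1: "Gamma (par_s (- m - n)) = (- 1) powi (m + n) * Gamma (- 1 / 12) * inverse (rising_fact (13 / 12) (m + n))"
    using rising_fact_neq_0[OF ni'(1), of "m + n"] by (simp add: field_simps)
  have "Gamma (par_c (- m)) * rising_fact (1 / 4) m = (- 1) powi m * Gamma (3 / 4)"
    using Gamma_minus_int[OF ni(2), of m] unfolding par by simp
  hence c: "Gamma (par_c (- m)) = (- 1) powi m * Gamma (3 / 4) / rising_fact (1 / 4) m"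
    using rising_fact_neq_0[OF ni'(2), of m] by (simp add: field_simps)
  moreover have sq: "(- 1 :: real) powi m * (- 1) powi m = 1"
    by (simp flip: power_int_mult_distrib)
  ultimately have 2: "inverse (Gamma (par_c (- m))) = rising_fact (1 / 4) m * (- 1) powi m / Gamma (3 / 4)"
  proof -
    have "inverse (X * T / R) = R * X / T" if "inverse X = X" for X T R :: real
      using that by (simp add: divide_inverse)
    from this[OF inverse_unique[OF sq]] show ?thesis unfolding c .
  qed
  have sgn: "(- 1 :: real) powi (m + n) * (- 1) powi m = (- 1) powi n"
  proof -
    have "(- 1 :: real) powi (m + n) * (- 1) powi m = (- 1) powi n * ((- 1) powi m * (- 1) powi m)"
      by (simp add: power_int_add)
    thus ?thesis unfolding sq by simp
  qed
  have "Gamma (par_s (- m - n)) / Gamma (par_c (- m)) =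
      Gamma (par_s (- m - n)) * inverse (Gamma (par_c (- m)))"
    by (rule divide_inverse)
  also have "\<dots> = ((- 1) powi (m + n) * (- 1) powi m) * (Gamma (- 1 / 12) / Gamma (3 / 4)) *
      rising_fact (1 / 4) m * inverse (rising_fact (13 / 12) (m + n))"
    unfolding 1 2 by (simp only: times_divide_eq_left times_divide_eq_right mult_ac)
  finally show ?thesis unfolding sgn .
qed

lemma Gamma_plus1_pos: "x > 0 \<Longrightarrow> Gamma (x + 1) = x * Gamma (x :: real)"
  by (rule Gamma_plus1) (auto elim!: nonpos_Ints_cases)

lemma two_powr_11_4: "2 powr (11 / 4) = 4 * (2 powr (1 / 4) * 2 powr (1 / 2 :: real))"
proof -
  have "(2 :: real) powr (11 / 4) = 2 powr 2 * 2 powr (3 / 4)" by (subst powr_add[symmetric]) simp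
  moreover have "(2 :: real) powr (3 / 4) = 2 powr (1 / 4) * 2 powr (1 / 2)" by (simp flip: powr_add)
  ultimately show ?thesis by simp
qed

lemma two_powr_half: "2 / sqrt pi * 2 powr (- 1 / 2) = 2 powr (1 / 2) / sqrt pi"
proof -
  have "(2 :: real) powr (- 1 / 2) * 2 powr 1 = 2 powr (1 / 2)" by (subst powr_add[symmetric]) simp
  hence "2 powr (1 / 2) = 2 * (2 :: real) powr (- 1 / 2)" by simp
  thus ?thesis by (simp only: times_divide_eq_left)
qed

text \<open>The part of the first formula independent of \<open>m\<close> and \<open>n\<close>. Its
  minus sign comes from \<open>Gamma (- 1 / 12) = - 12 * Gamma (11 / 12)\<close>.\<close>

lemma Gamma_constant_plus:
  "2 / sqrt pi * 2 powr (- 1 / 2) * (Gamma (- 1 / 12) / Gamma (3 / 4)) =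
     - (2 powr (11 / 4) * 3 powr (- 3 / 8) * inverse (Gamma (4 / 3)) * sqrt (sqrt 3 + 1))"
proof -
  have g: "Gamma (11 / 12 :: real) = - 1 / 12 * Gamma (- 1 / 12)" "Gamma (4 / 3 :: real) = Gamma (1 / 3) / 3"
    using Gamma_plus1_notin_Ints[of "- 1 / 12"] par_notin_Ints(1)[of 0] Gamma_plus1_pos[of "1 / 3"]
    by simp_all
  have p: "Gamma (1 / 3 :: real) \<noteq> 0" "Gamma (3 / 4 :: real) \<noteq> 0"
    by (rule less_imp_neq[OF Gamma_real_pos, symmetric], simp)+
  have "N / T = - 12 * X / G" if "d * G / T = X" "d = - 1 / 12 * N" "G \<noteq> 0" for N T X G d :: real
    using that by (auto simp: field_simps)
  from this[OF Gamma_11_12 g(1) p(1)] have eq: "Gamma (- 1 / 12) / Gamma (3 / 4) =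
      - 12 * (2 powr (1 / 4) * sqrt pi * 3 powr (- 3 / 8) * sqrt (sqrt 3 + 1)) / Gamma (1 / 3)" .
  have aux: "h / P * X = - (4 * (t * h) * th * inverse (G / 3) * r)"
    if "X = - 12 * (t * P * th * r) / G" "P \<noteq> 0" for h P X t th G r :: real
    unfolding that(1) using that(2) by simp
  show ?thesis unfolding two_powr_11_4 g(2) two_powr_half by (rule aux[OF eq]) simp
qed

text \<open>Division by \<open>branch_ratio\<close> cancels the negative value
  \<open>Gamma (- 1 / 12)\<close> and leaves \<open>Gamma (5 / 12) / Gamma (1 / 4)\<close>, so no
  minus sign appears.\<close>

lemma Gamma_constant_minus:
  "2 / sqrt pi * 2 powr (- 1 / 2) * (Gamma (- 1 / 12) / Gamma (3 / 4)) / branch_ratio =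
     2 powr (11 / 4) * 3 powr (- 3 / 8) * inverse (Gamma (4 / 3)) * sqrt (sqrt 3 - 1)"
proof -
  have g: "Gamma (5 / 4 :: real) = 1 / 4 * Gamma (1 / 4)" "Gamma (4 / 3 :: real) = Gamma (1 / 3) / 3"
    using Gamma_plus1_pos[of "1 / 4"] Gamma_plus1_pos[of "1 / 3"] by simp_all
  have p: "Gamma (1 / 3 :: real) \<noteq> 0" "Gamma (3 / 4 :: real) \<noteq> 0" "Gamma (1 / 4 :: real) \<noteq> 0"
      "Gamma (5 / 12 :: real) \<noteq> 0"
    by (rule less_imp_neq[OF Gamma_real_pos, symmetric], simp)+
  have p': "Gamma (- 1 / 12 :: real) \<noteq> 0"
    using Gamma_neq_0_notin_Ints par_notin_Ints(1)[of 0] by simp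
  have three: "27 powr (1 / 4) * 3 powr (- 1 / 8) = 3 * (3 :: real) powr (- 3 / 8)"
  proof -
    have "27 powr (1 / 4) = (3 :: real) powr (3 / 4)" using powr_powr[of 3 3 "1 / 4"] by simp
    moreover have "(3 :: real) powr (3 / 4) * 3 powr (- 1 / 8) = 3 powr 1 * 3 powr (- 3 / 8)"
      by (subst (1 2) powr_add[symmetric]) simp
    ultimately show ?thesis by simp
  qed
  have "Gamma (- 1 / 12) / Gamma (3 / 4) / branch_ratio = 4 * 27 powr (1 / 4) * (Gamma (5 / 12) / Gamma (1 / 4))"
  proof -
    have "N / T / (N * (1 / 4 * q) / (T * b * k)) = 4 * k * (b / q)" if "N \<noteq> 0" "T \<noteq> 0" for N T q b k :: real
      using that by simp
    from this[OF p' p(2)] show ?thesis unfolding branch_ratio_def g(1) .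
  qed
  also have "Gamma (5 / 12) / Gamma (1 / 4) =
      2 powr (1 / 4) * sqrt pi * 3 powr (- 1 / 8) * sqrt (sqrt 3 - 1) / Gamma (1 / 3)"
  proof -
    have "b / h = X / G" if "b * G / h = X" "G \<noteq> 0" for b h X G :: real
      using that by auto
    from this[OF Gamma_5_12 p(1)] show ?thesis .
  qed
  also have "4 * 27 powr (1 / 4) * \<dots> = 4 * (27 powr (1 / 4) * 3 powr (- 1 / 8)) *
      (2 powr (1 / 4) * sqrt pi * sqrt (sqrt 3 - 1) / Gamma (1 / 3))"
    by (simp only: times_divide_eq_right times_divide_eq_left mult_ac)
  finally have eq: "Gamma (- 1 / 12) / Gamma (3 / 4) / branch_ratio =
      12 * (2 powr (1 / 4) * sqrt pi * 3 powr (- 3 / 8) * sqrt (sqrt 3 - 1)) / Gamma (1 / 3)"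
    unfolding three by (simp only: times_divide_eq_right times_divide_eq_left mult_ac)
  have aux: "h / P * Y / R = 4 * (t * h) * th * inverse (G / 3) * r"
    if "Y / R = 12 * (t * P * th * r) / G" "P \<noteq> 0" for h P Y R t th G r :: real
    unfolding times_divide_eq_right[symmetric] that(1) using that(2) by simp
  show ?thesis unfolding two_powr_11_4 g(2) two_powr_half by (rule aux[OF eq]) simp
qed

subsection \<open>Legendre functions\<close>

lemma powr_square_powr: "x > 0 \<Longrightarrow> (x\<^sup>2) powr a = x powr (2 * a)" for x :: real
  by (simp add: powr_powr flip: powr_numeral)

lemma legendre_Qhat_coth:
  assumes "\<xi> > 0"
  shows "legendre_Qhat \<nu> \<mu> (coth \<xi>) =
    sqrt pi / 2 powr (\<nu> + 1) * (Gamma (\<nu> + \<mu> + 1) / Gamma (\<nu> + 3 / 2)) *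
    (sinh \<xi> powr (- \<mu>) * tanh \<xi> powr (\<nu> + \<mu> + 1)) * legendre_2F1 (\<nu> + \<mu> + 1) (\<nu> + 3 / 2) ((tanh \<xi>)\<^sup>2)"
proof -
  have sh: "sinh \<xi> > 0" and ch: "cosh \<xi> > 0" using assms by simp_all
  have "(coth \<xi>)\<^sup>2 - 1 = ((cosh \<xi>)\<^sup>2 - (sinh \<xi>)\<^sup>2) / (sinh \<xi>)\<^sup>2"
    using sh by (simp add: coth_def power_divide field_simps)
  also have "(cosh \<xi>)\<^sup>2 - (sinh \<xi>)\<^sup>2 = 1" by (rule hyperbolic_pythagoras)
  finally have "((coth \<xi>)\<^sup>2 - 1) powr (\<mu> / 2) = sinh \<xi> powr (- \<mu>)"
    using sh by (simp add: powr_divide powr_square_powr powr_minus_divide)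
  moreover have "coth \<xi> = 1 / tanh \<xi>" by (simp add: coth_def tanh_def)
  moreover have "tanh \<xi> > 0" using assms by simp
  moreover have e: "\<nu> / 2 + \<mu> / 2 + 1 / 2 = (\<nu> + \<mu> + 1) / 2" "\<nu> / 2 + \<mu> / 2 + 1 = (\<nu> + \<mu> + 1) / 2 + 1 / 2"
    by (simp_all add: field_simps)
  ultimately show ?thesis
    unfolding legendre_Qhat_def legendre_2F1_def e by (simp add: powr_divide power_divide)
qed

lemma legendre_Qhat_eq_\<Phi>\<^sub>1:
  fixes n m :: int
  assumes \<xi>: "\<xi> > 0"
  shows "legendre_Qhat (- 3/4 - of_int m) (- 1/3 - of_int n) (coth \<xi>) =
    sqrt pi * 2 powr (of_int m - 1 / 4) * sinh \<xi> powr (1 / 3 + of_int n) *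
      tanh \<xi> powr par_s (- m - n) * \<Phi>\<^sub>1 (par_s (- m - n)) (par_c (- m)) ((tanh \<xi>)\<^sup>2)"
proof -
  have e: "- 3/4 - real_of_int m + (- 1/3 - real_of_int n) + 1 = par_s (- m - n)"
    "- 3/4 - real_of_int m + 3 / 2 = par_c (- m)" "- (- 1/3 - real_of_int n) = 1 / 3 + of_int n"
    by simp_all
  have "- 3/4 - real_of_int m + 1 = - (of_int m - 1 / 4)" by simp
  hence 2: "sqrt pi / 2 powr (- 3/4 - real_of_int m + 1) = sqrt pi * 2 powr (of_int m - 1 / 4)"
    by (simp only: powr_minus divide_inverse inverse_inverse_eq)
  show ?thesis
    unfolding legendre_Qhat_coth[OF \<xi>] e 2 \<Phi>\<^sub>1_def
    by (simp only: times_divide_eq_left times_divide_eq_right mult_ac)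
qed

text \<open>The degree is \<open>- 1 - \<nu>\<close> for the degree \<open>\<nu>\<close> of the
  first formula, an exchange that preserves the Legendre equation. It replaces \<open>(s, c)\<close>
  by \<open>(s + 2 - 2 * c, 2 - c)\<close>. The factors \<open>x powr (1 - c)\<close> and
  \<open>4 powr (c - 1)\<close> of \<open>\<Phi>\<^sub>2\<close> absorb the changed powers of
  \<open>tanh \<xi>\<close> and 2, so that the prefactor is the one found for
  \<open>\<Phi>\<^sub>1\<close>.\<close>

lemma legendre_Qhat_eq_\<Phi>\<^sub>2:
  fixes n m :: int
  assumes \<xi>: "\<xi> > 0"
  shows "legendre_Qhat (- 1/4 + of_int m) (- 1/3 - of_int n) (coth \<xi>) =
    sqrt pi * 2 powr (of_int m - 1 / 4) * sinh \<xi> powr (1 / 3 + of_int n) *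
      tanh \<xi> powr par_s (- m - n) * \<Phi>\<^sub>2 (par_s (- m - n)) (par_c (- m)) ((tanh \<xi>)\<^sup>2)"
proof -
  define s c where sc: "s = par_s (- m - n)" "c = par_c (- m)"
  have e: "- 1/4 + real_of_int m + (- 1/3 - real_of_int n) + 1 = s + 2 - 2 * c"
    "- 1/4 + real_of_int m + 3 / 2 = 2 - c" "- (- 1/3 - real_of_int n) = 1 / 3 + of_int n"
    by (simp_all add: sc)
  have t: "tanh \<xi> > 0" using \<xi> by simp
  have "tanh \<xi> powr (s + 2 - 2 * c) = tanh \<xi> powr s * tanh \<xi> powr (2 * (1 - c))"
    by (simp add: algebra_simps flip: powr_add)
  hence 1: "tanh \<xi> powr (s + 2 - 2 * c) = tanh \<xi> powr s * ((tanh \<xi>)\<^sup>2) powr (1 - c)"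
    using t by (simp add: powr_square_powr)
  have "(4 :: real) powr (c - 1) = 2 powr (2 * (c - 1))"
    using powr_square_powr[of 2 "c - 1"] by simp
  hence "2 powr (of_int m - 1 / 4) * 4 powr (c - 1) = 2 powr (- (- 1/4 + real_of_int m + 1))"
    by (simp add: sc flip: powr_add)
  hence 2: "sqrt pi / 2 powr (- 1/4 + real_of_int m + 1) = sqrt pi * (2 powr (of_int m - 1 / 4) * 4 powr (c - 1))"
    by (simp only: powr_minus divide_inverse[of "sqrt pi"])
  show ?thesis
    unfolding legendre_Qhat_coth[OF \<xi>] e 1 2 \<Phi>\<^sub>2_def sc[symmetric]
    by (simp only: times_divide_eq_left times_divide_eq_right mult_ac)
qed

section \<open>The hyperbolic parametrization of the covering\<close>

lemma cosh_triple: "cosh x = 4 * cosh (x / 3) ^ 3 - 3 * cosh (x / 3 :: real)"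
proof -
  define y where "y = x / 3"
  have "cosh x = cosh (y + y + y)" by (simp add: y_def)
  also have "\<dots> = cosh y ^ 3 + 3 * cosh y * (sinh y)\<^sup>2"
    by (simp only: cosh_add sinh_add) (simp add: algebra_simps eval_nat_numeral)
  also have "(sinh y)\<^sup>2 = (cosh y)\<^sup>2 - 1" by (rule sinh_square_eq)
  finally show ?thesis unfolding y_def[symmetric] by (simp add: algebra_simps eval_nat_numeral)
qed

text \<open>The two equations evaluate the homogenized \<open>oct_f\<close> and \<open>oct_e\<close>
  at the ratio \<open>- A_minus \<xi> / A_plus \<xi>\<close>. They explain the choice of
  \<open>A_plus\<close> and \<open>A_minus\<close>: the first form becomes constant, and the second
  becomes the triple-angle polynomial in \<open>cosh (\<xi> / 3)\<close>.\<close>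

lemma A_plus_minus_facts:
  assumes "\<xi> > 0"
  shows "A_plus \<xi> > A_minus \<xi>" "A_minus \<xi> > 0"
    "(A_plus \<xi>)\<^sup>2 - 14 * A_plus \<xi> * A_minus \<xi> + (A_minus \<xi>)\<^sup>2 = 4"
    "(A_plus \<xi> - A_minus \<xi>) * ((A_plus \<xi>)\<^sup>2 + 34 * A_plus \<xi> * A_minus \<xi> + (A_minus \<xi>)\<^sup>2) = 8 * cosh \<xi>"
proof -
  define c where "c = cosh (\<xi> / 3)"
  define w where "w = sqrt ((4 * c\<^sup>2 - 1) / 3)"
  have c: "c > 1" unfolding c_def using assms cosh_real_strict_mono[of 0 "\<xi> / 3"] by simp
  hence c2: "c\<^sup>2 > 1" by (simp add: one_less_power)
  hence w2: "w\<^sup>2 = (4 * c\<^sup>2 - 1) / 3" by (simp add: w_def)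
  have A: "A_plus \<xi> = c + w" "A_minus \<xi> = w - c" by (simp_all add: A_plus_def A_minus_def c_def w_def)
  have "c < w" unfolding w_def by (rule real_less_rsqrt) (use c2 in simp)
  thus "A_plus \<xi> > A_minus \<xi>" "A_minus \<xi> > 0" using c by (simp_all add: A)
  have "(A_plus \<xi>)\<^sup>2 - 14 * A_plus \<xi> * A_minus \<xi> + (A_minus \<xi>)\<^sup>2 = 16 * c\<^sup>2 - 12 * w\<^sup>2"
    unfolding A by (simp add: power2_eq_square algebra_simps)
  thus "(A_plus \<xi>)\<^sup>2 - 14 * A_plus \<xi> * A_minus \<xi> + (A_minus \<xi>)\<^sup>2 = 4" unfolding w2 by (simp add: field_simps)
  have "(A_plus \<xi> - A_minus \<xi>) * ((A_plus \<xi>)\<^sup>2 + 34 * A_plus \<xi> * A_minus \<xi> + (A_minus \<xi>)\<^sup>2) =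
      2 * c * (36 * w\<^sup>2 - 32 * c\<^sup>2)"
    unfolding A by (simp add: power2_eq_square algebra_simps)
  also have "36 * w\<^sup>2 = 48 * c\<^sup>2 - 12" unfolding w2 by (simp add: field_simps)
  also have "2 * c * (48 * c\<^sup>2 - 12 - 32 * c\<^sup>2) = 8 * (4 * c ^ 3 - 3 * c)" by (simp add: algebra_simps eval_nat_numeral)
  finally show "(A_plus \<xi> - A_minus \<xi>) * ((A_plus \<xi>)\<^sup>2 + 34 * A_plus \<xi> * A_minus \<xi> + (A_minus \<xi>)\<^sup>2) = 8 * cosh \<xi>"
    unfolding cosh_triple[of \<xi>] c_def .
qed

text \<open>Formulated for general \<open>a\<close>, \<open>b\<close>, \<open>d\<close> in order to
  serve both ratios, with \<open>d = cosh \<xi>\<close> for one and \<open>d = - cosh \<xi>\<close>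
  for the other.\<close>

lemma oct_at_A_ratio:
  fixes a b d :: real
  assumes "a \<noteq> 0" "a\<^sup>2 - 14 * a * b + b\<^sup>2 = 4" "(a - b) * (a\<^sup>2 + 34 * a * b + b\<^sup>2) = 8 * d"
  shows "oct_f (- b / a) = 4 / a\<^sup>2" "oct_e (- b / a) = 8 * d / a ^ 3"
    and "d \<noteq> 0 \<Longrightarrow> 1 - oct_R (- b / a) = 1 / d\<^sup>2"
proof -
  have "oct_f (- b / a) = (a\<^sup>2 - 14 * a * b + b\<^sup>2) / a\<^sup>2"
    using assms(1) by (simp add: oct_f_def field_simps power2_eq_square)
  thus f: "oct_f (- b / a) = 4 / a\<^sup>2" unfolding assms(2) .
  have "oct_e (- b / a) = (a - b) * (a\<^sup>2 + 34 * a * b + b\<^sup>2) / a ^ 3"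
    using assms(1) by (simp add: oct_e_def field_simps eval_nat_numeral)
  thus e: "oct_e (- b / a) = 8 * d / a ^ 3" unfolding assms(3) .
  assume d: "d \<noteq> 0"
  have "oct_e (- b / a) \<noteq> 0" unfolding e using d assms(1) by simp
  hence "1 - oct_R (- b / a) = oct_f (- b / a) ^ 3 / (oct_e (- b / a))\<^sup>2"
    using oct_identity[of "- b / a"] by (simp add: oct_R_def divide_simps)
  also have "\<dots> = 1 / d\<^sup>2"
    unfolding f e using assms(1) by (simp add: power_divide power_mult_distrib flip: power_mult)
  finally show "1 - oct_R (- b / a) = 1 / d\<^sup>2" .
qed

text \<open>With \<open>s = - 1/12 - m - n\<close> the exponent of \<open>sinh \<xi>\<close> is
  \<open>1/3 + n + s = 1/4 - m\<close> and that of \<open>A\<close> is \<open>- 3 * s\<close>;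
  \<open>cosh \<xi>\<close> cancels between \<open>tanh \<xi>\<close> and the value of
  \<open>oct_e\<close>.\<close>

lemma Qhat_prefactor:
  fixes n m :: int and \<xi> A :: real
  assumes "\<xi> > 0" "A > 0"
  shows "2 / pi * (sqrt pi * 2 powr (of_int m - 1 / 4) * sinh \<xi> powr (1 / 3 + of_int n) *
      tanh \<xi> powr par_s (- m - n)) * (8 * cosh \<xi> / A ^ 3) powr par_s (- m - n) =
    2 / sqrt pi * 2 powr (- 1 / 2) * 2 powr (- 2 * of_int m - 3 * of_int n) * sinh \<xi> powr (1 / 4 - of_int m) *
      A powr (1 / 4 + 3 * of_int m + 3 * of_int n)"
proof -
  define s where "s = par_s (- m - n)"
  have sh: "sinh \<xi> > 0" and ch: "cosh \<xi> > 0" using assms by simp_all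
  have "2 / (r * r) * r = 2 / r" if "r \<noteq> 0" for r :: real using that by simp
  from this[of "sqrt pi"] have 1: "2 / pi * sqrt pi = 2 / sqrt pi" by simp
  have 8: "8 powr s = 2 powr (3 * s)" using powr_powr[of 2 3 s] by simp
  have A3: "(A ^ 3) powr s = A powr (3 * s)" using assms by (simp add: powr_powr flip: powr_numeral)
  have A: "A powr (1 / 4 + 3 * of_int m + 3 * of_int n) = inverse (A powr (3 * s))"
    by (simp add: s_def algebra_simps flip: powr_minus)
  have "tanh \<xi> powr s * (8 * cosh \<xi> / A ^ 3) powr s = (tanh \<xi> * (8 * cosh \<xi> / A ^ 3)) powr s"
    using assms ch by (subst powr_mult) auto
  also have "tanh \<xi> * (8 * cosh \<xi> / A ^ 3) = 8 * sinh \<xi> / A ^ 3"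
    using ch by (simp add: tanh_def)
  also have "(8 * sinh \<xi> / A ^ 3) powr s = 2 powr (3 * s) * sinh \<xi> powr s * inverse (A powr (3 * s))"
    using sh assms(2) by (simp add: powr_divide powr_mult 8 A3 inverse_eq_divide)
  finally have T: "tanh \<xi> powr s * (8 * cosh \<xi> / A ^ 3) powr s =
    2 powr (3 * s) * sinh \<xi> powr s * inverse (A powr (3 * s))" .
  have S: "sinh \<xi> powr (1 / 3 + of_int n) * sinh \<xi> powr s = sinh \<xi> powr (1 / 4 - of_int m)"
    by (simp add: s_def flip: powr_add)
  have "of_int m - 1 / 4 + 3 * s = - 1 / 2 + (- 2 * of_int m - 3 * of_int n)" by (simp add: s_def)
  hence D: "2 powr (of_int m - 1 / 4) * 2 powr (3 * s) = 2 powr (- 1 / 2) * (2 :: real) powr (- 2 * of_int m - 3 * of_int n)"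
    by (simp only: powr_add[symmetric])
  have "2 / pi * (sqrt pi * 2 powr (of_int m - 1 / 4) * sinh \<xi> powr (1 / 3 + of_int n) *
      tanh \<xi> powr s) * (8 * cosh \<xi> / A ^ 3) powr s =
      (2 / pi * sqrt pi) * 2 powr (of_int m - 1 / 4) * sinh \<xi> powr (1 / 3 + of_int n) *
        (tanh \<xi> powr s * (8 * cosh \<xi> / A ^ 3) powr s)"
    by (simp only: mult_ac)
  also have "\<dots> = (2 / pi * sqrt pi) * (2 powr (of_int m - 1 / 4) * 2 powr (3 * s)) *
      (sinh \<xi> powr (1 / 3 + of_int n) * sinh \<xi> powr s) * inverse (A powr (3 * s))"
    unfolding T by (simp only: mult_ac)
  also have "\<dots> = 2 / sqrt pi * 2 powr (- 1 / 2) * 2 powr (- 2 * of_int m - 3 * of_int n) *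
      sinh \<xi> powr (1 / 4 - of_int m) * A powr (1 / 4 + 3 * of_int m + 3 * of_int n)"
    unfolding 1 D S A by (simp only: mult_ac)
  finally show ?thesis unfolding s_def .
qed

lemma C_oct_factored:
  "C_oct n m = 2 powr (11 / 4) * 2 powr (- 2 * of_int m - 3 * of_int n) * 3 powr (- 3 / 8) *
     rising_fact (1 / 4) m * inverse (rising_fact (13 / 12) (m + n)) * inverse (Gamma (4 / 3))"
  unfolding C_oct_def by (simp add: algebra_simps flip: powr_add)

lemma Qhat_branch_1:
  fixes n m :: int
  assumes \<xi>: "\<xi> > 0"
  shows "2 / pi * legendre_Qhat (- 3/4 - of_int m) (- 1/3 - of_int n) (coth \<xi>) =
    C_oct n m * sinh \<xi> powr (1/4 - of_int m) *
      (- ((- 1) powi n) * (sqrt (sqrt 3 + 1) * A_plus \<xi> powr (1/4 + 3 * of_int m + 3 * of_int n)) *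
       (Gamma (par_c (- m)) / Gamma (par_s (- m - n)) * oct_Z (- m - n) (- m) (- A_minus \<xi> / A_plus \<xi>)))" (is "_ = ?rhs")
    and "- A_minus \<xi> / A_plus \<xi> \<in> oct_S"
proof -
  define A B u s c Z where defs: "A = A_plus \<xi>" "B = A_minus \<xi>" "u = - B / A" "s = par_s (- m - n)" "c = par_c (- m)"
    "Z = oct_Z (- m - n) (- m) u"
  note AB = A_plus_minus_facts[OF \<xi>, folded defs(1,2)]
  have A: "A > 0" using AB by simp
  have ch: "cosh \<xi> > 0" by simp
  note o = oct_at_A_ratio[OF _ AB(3,4), folded defs(3)]
  have u: "u < 0" "u > -1" using AB A by (simp_all add: defs(3) field_simps)
  show uS: "- A_minus \<xi> / A_plus \<xi> \<in> oct_S"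
    using u A o(1) unfolding defs(1-3)[symmetric] by (simp add: oct_S_def)
  have e: "oct_e u = 8 * cosh \<xi> / A ^ 3" using o(2) A by simp
  have R: "oct_R u = (tanh \<xi>)\<^sup>2"
  proof -
    have "1 - oct_R u = 1 / (cosh \<xi>)\<^sup>2" using o(3) A ch by simp
    moreover have "(tanh \<xi>)\<^sup>2 = 1 - 1 / (cosh \<xi>)\<^sup>2"
      using ch by (simp add: tanh_def power_divide sinh_square_eq diff_divide_distrib)
    ultimately show ?thesis by simp
  qed
  have e0: "oct_e u > 0" unfolding e using A ch by simp
  have "Z = \<Phi>\<^sub>1 s c (oct_R u) * oct_e u powr (- s)"
    using u unfolding defs(4-6) by (simp add: oct_Z_def oct_branch_def)
  moreover have "oct_e u powr s * oct_e u powr (- s) = 1" using e0 by (simp flip: powr_add)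
  ultimately have \<Phi>: "\<Phi>\<^sub>1 s c ((tanh \<xi>)\<^sup>2) = (8 * cosh \<xi> / A ^ 3) powr s * Z"
    unfolding R e by simp
  define W where "W = Gamma c / Gamma s * Z"
  have nz: "Gamma s \<noteq> 0" "Gamma c \<noteq> 0" unfolding defs by (intro Gamma_neq_0_notin_Ints par_notin_Ints)+
  note gq = Gamma_quotient_par[of m n, folded defs(4,5)]
  define P where "P = 2 powr (- 2 * real_of_int m - 3 * of_int n) * sinh \<xi> powr (1 / 4 - of_int m) *
      A powr (1 / 4 + 3 * of_int m + 3 * of_int n)"
  have "2 / pi * legendre_Qhat (- 3/4 - of_int m) (- 1/3 - of_int n) (coth \<xi>) =
     (2 / pi * (sqrt pi * 2 powr (of_int m - 1 / 4) * sinh \<xi> powr (1 / 3 + of_int n) *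
      tanh \<xi> powr s) * (8 * cosh \<xi> / A ^ 3) powr s) * Z"
    unfolding legendre_Qhat_eq_\<Phi>\<^sub>1[OF \<xi>] defs(4,5)[symmetric] \<Phi> by simp
  also have "\<dots> = 2 / sqrt pi * 2 powr (- 1 / 2) * P * Z"
    unfolding defs(4) Qhat_prefactor[OF \<xi> A] P_def by simp
  also have "\<dots> = 2 / sqrt pi * 2 powr (- 1 / 2) * (Gamma s / Gamma c) * P * W"
    using nz by (simp add: W_def)
  also have "\<dots> = (2 / sqrt pi * 2 powr (- 1 / 2) * (Gamma (- 1 / 12) / Gamma (3 / 4))) *
      ((- 1) powi n * rising_fact (1 / 4) m * inverse (rising_fact (13 / 12) (m + n)) * P * W)"
    unfolding gq by (simp only: times_divide_eq_left times_divide_eq_right divide_divide_eq_left mult_ac)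
  also have "\<dots> = ?rhs"
    unfolding Gamma_constant_plus C_oct_factored defs[symmetric] W_def[symmetric] P_def
    by (simp only: mult_minus_left mult_minus_right mult_ac)
  finally show "2 / pi * legendre_Qhat (- 3/4 - of_int m) (- 1/3 - of_int n) (coth \<xi>) = ?rhs" .
qed

lemma Qhat_branch_2:
  fixes n m :: int
  assumes \<xi>: "\<xi> > 0"
  shows "2 / pi * legendre_Qhat (- 1/4 + of_int m) (- 1/3 - of_int n) (coth \<xi>) =
    C_oct n m * sinh \<xi> powr (1/4 - of_int m) *
      ((- 1) powi m * (sqrt (sqrt 3 - 1) * A_minus \<xi> powr (1/4 + 3 * of_int m + 3 * of_int n)) *
       (Gamma (par_c (- m)) / Gamma (par_s (- m - n)) * oct_Z (- m - n) (- m) (- A_plus \<xi> / A_minus \<xi>)))" (is "_ = ?rhs")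
    and "- A_plus \<xi> / A_minus \<xi> \<in> oct_S"
proof -
  define A B u s c Z where defs: "A = A_plus \<xi>" "B = A_minus \<xi>" "u = - A / B" "s = par_s (- m - n)" "c = par_c (- m)"
    "Z = oct_Z (- m - n) (- m) u"
  note AB = A_plus_minus_facts[OF \<xi>, folded defs(1,2)]
  have B: "B > 0" using AB by simp
  have ch: "cosh \<xi> > 0" by simp
  \<comment> \<open>Exchanging the roles of the two numbers preserves the first form and changes the
    sign of the second.\<close>
  have "B\<^sup>2 - 14 * B * A + A\<^sup>2 = 4" "(B - A) * (B\<^sup>2 + 34 * B * A + A\<^sup>2) = 8 * (- cosh \<xi>)"
    using AB(3,4) by (simp_all add: algebra_simps)
  note o = oct_at_A_ratio[OF _ this, folded defs(3)]
  have u: "u < -1" using AB by (simp add: defs(3) field_simps)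
  show uS: "- A_plus \<xi> / A_minus \<xi> \<in> oct_S"
    using u B o(1) unfolding defs(1-3)[symmetric] by (simp add: oct_S_def)
  have e: "- oct_e u = 8 * cosh \<xi> / B ^ 3" using o(2) B by simp
  have R: "oct_R u = (tanh \<xi>)\<^sup>2"
  proof -
    have "1 - oct_R u = 1 / (cosh \<xi>)\<^sup>2" using o(3) B ch by simp
    moreover have "(tanh \<xi>)\<^sup>2 = 1 - 1 / (cosh \<xi>)\<^sup>2"
      using ch by (simp add: tanh_def power_divide sinh_square_eq diff_divide_distrib)
    ultimately show ?thesis by simp
  qed
  have e0: "- oct_e u > 0" unfolding e using B ch by simp
  have r0: "branch_ratio \<noteq> 0"
  proof -
    have "Gamma (3 / 4) \<noteq> (0 :: real)" "Gamma (5 / 12) \<noteq> (0 :: real)" "Gamma (5 / 4) \<noteq> (0 :: real)"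
      by (rule less_imp_neq[OF Gamma_real_pos, symmetric], simp)+
    moreover have "Gamma (- 1 / 12 :: real) \<noteq> 0"
      using Gamma_neq_0_notin_Ints par_notin_Ints(1)[of 0] by simp
    ultimately show ?thesis by (simp add: branch_ratio_def)
  qed
  define \<epsilon> where "\<epsilon> = (- 1 :: real) powi (- m - n)"
  have \<epsilon>: "\<epsilon> * \<epsilon> = 1" unfolding \<epsilon>_def by (simp flip: power_int_mult_distrib)
  have "Z = branch_ratio * \<epsilon> * \<Phi>\<^sub>2 s c (oct_R u) * (- oct_e u) powr (- s)"
    using u unfolding defs(4-6) \<epsilon>_def by (simp add: oct_Z_def oct_branch_def)
  moreover have "(- oct_e u) powr s * (- oct_e u) powr (- s) = 1" using e0 by (simp flip: powr_add)
  ultimately have "(- oct_e u) powr s * (\<epsilon> * Z) / branch_ratio = (\<epsilon> * \<epsilon>) * \<Phi>\<^sub>2 s c (oct_R u)"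
    using r0 by simp
  hence \<Phi>: "\<Phi>\<^sub>2 s c ((tanh \<xi>)\<^sup>2) = (8 * cosh \<xi> / B ^ 3) powr s * (\<epsilon> * Z / branch_ratio)"
    unfolding R e \<epsilon> by simp
  \<comment> \<open>The sign of the branch, multiplied by \<open>(- 1) powi n\<close> from the Gamma
    quotient, gives the sign of the second formula.\<close>
  have sgn: "\<epsilon> * (- 1) powi n = (- 1) powi m"
    unfolding \<epsilon>_def by (simp add: power_int_minus_one_minus flip: power_int_add)
  define W where "W = Gamma c / Gamma s * Z"
  have nz: "Gamma s \<noteq> 0" "Gamma c \<noteq> 0" unfolding defs by (intro Gamma_neq_0_notin_Ints par_notin_Ints)+
  note gq = Gamma_quotient_par[of m n, folded defs(4,5)]
  define P where "P = 2 powr (- 2 * real_of_int m - 3 * of_int n) * sinh \<xi> powr (1 / 4 - of_int m) *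
      B powr (1 / 4 + 3 * of_int m + 3 * of_int n)"
  have "2 / pi * legendre_Qhat (- 1/4 + of_int m) (- 1/3 - of_int n) (coth \<xi>) =
     (2 / pi * (sqrt pi * 2 powr (of_int m - 1 / 4) * sinh \<xi> powr (1 / 3 + of_int n) *
      tanh \<xi> powr s) * (8 * cosh \<xi> / B ^ 3) powr s) * (\<epsilon> * Z / branch_ratio)"
    unfolding legendre_Qhat_eq_\<Phi>\<^sub>2[OF \<xi>] defs(4,5)[symmetric] \<Phi> by simp
  also have "\<dots> = 2 / sqrt pi * 2 powr (- 1 / 2) * P * (\<epsilon> * Z / branch_ratio)"
    unfolding defs(4) Qhat_prefactor[OF \<xi> B] P_def by simp
  also have "\<dots> = 2 / sqrt pi * 2 powr (- 1 / 2) * (Gamma s / Gamma c) * P * (\<epsilon> / branch_ratio * W)"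
    using nz by (simp add: W_def)
  also have "\<dots> = (2 / sqrt pi * 2 powr (- 1 / 2) * (Gamma (- 1 / 12) / Gamma (3 / 4)) / branch_ratio) *
      ((\<epsilon> * (- 1) powi n) * rising_fact (1 / 4) m * inverse (rising_fact (13 / 12) (m + n)) * P * W)"
    unfolding gq by (simp only: times_divide_eq_left times_divide_eq_right divide_divide_eq_left mult_ac)
  also have "\<dots> = ?rhs"
    unfolding Gamma_constant_minus sgn C_oct_factored defs[symmetric] W_def[symmetric] P_def by (simp only: mult_ac)
  finally show "2 / pi * legendre_Qhat (- 1/4 + of_int m) (- 1/3 - of_int n) (coth \<xi>) = ?rhs" .
qed

theorem theorem4p1:
  fixes n m :: int and \<xi> :: real
  assumes "\<xi> > 0"
  shows "A_plus \<xi> > 0 \<and> A_minus \<xi> > 0 \<and>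
    complex_of_real (2 / pi * legendre_Qhat (- 3/4 - of_int m) (- 1/3 - of_int n) (coth \<xi>)) =
      complex_of_real (C_oct n m * sinh \<xi> powr (1/4 - of_int m)) *
        (- ((- 1) powi n) *
         complex_of_real (sqrt (sqrt 3 + 1) * A_plus \<xi> powr (1/4 + 3 * of_int m + 3 * of_int n)) *
         oct_r n m (complex_of_real (- A_minus \<xi> / A_plus \<xi>))) \<and>
    complex_of_real (2 / pi * legendre_Qhat (- 1/4 + of_int m) (- 1/3 - of_int n) (coth \<xi>)) =
      complex_of_real (C_oct n m * sinh \<xi> powr (1/4 - of_int m)) *
        ((- 1) powi m *
         complex_of_real (sqrt (sqrt 3 - 1) * A_minus \<xi> powr (1/4 + 3 * of_int m + 3 * of_int n)) *
         oct_r n m (complex_of_real (- A_plus \<xi> / A_minus \<xi>)))"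
proof (intro conjI)
  have sgn: "(- 1 :: complex) powi k = of_real ((- 1) powi k)" for k
    by simp
  show "A_minus \<xi> > 0" "A_plus \<xi> > 0" using A_plus_minus_facts(1,2)[OF assms] by simp_all
  show "complex_of_real (2 / pi * legendre_Qhat (- 3/4 - of_int m) (- 1/3 - of_int n) (coth \<xi>)) =
      complex_of_real (C_oct n m * sinh \<xi> powr (1/4 - of_int m)) *
        (- ((- 1) powi n) *
         complex_of_real (sqrt (sqrt 3 + 1) * A_plus \<xi> powr (1/4 + 3 * of_int m + 3 * of_int n)) *
         oct_r n m (complex_of_real (- A_minus \<xi> / A_plus \<xi>)))"
    unfolding Qhat_branch_1(1)[OF assms] oct_r_of_real[OF Qhat_branch_1(2)[OF assms]] sgn
    by (simp only: of_real_mult of_real_minus)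
  show "complex_of_real (2 / pi * legendre_Qhat (- 1/4 + of_int m) (- 1/3 - of_int n) (coth \<xi>)) =
      complex_of_real (C_oct n m * sinh \<xi> powr (1/4 - of_int m)) *
        ((- 1) powi m *
         complex_of_real (sqrt (sqrt 3 - 1) * A_minus \<xi> powr (1/4 + 3 * of_int m + 3 * of_int n)) *
         oct_r n m (complex_of_real (- A_plus \<xi> / A_minus \<xi>)))"
    unfolding Qhat_branch_2(1)[OF assms] oct_r_of_real[OF Qhat_branch_2(2)[OF assms]] sgn
    by (simp only: of_real_mult)
qed

end
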